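(* Let $\mathcal{S}$ be a separable metric space, $\mu$ a Borel probability measure on $\mathcal{S}$, and $\kappa:\mathcal{S}\times\mathcal{S}\to[0,\infty)$ a symmetric kernel with $\kappa\in L^1(\mathcal{S}\times\mathcal{S},\mu\otimes\mu)$. Suppose that $\kappa$ is irreducible, that $\kappa$ is continuous at $(\mu\otimes\mu)$-almost every point of $\mathcal{S}\times\mathcal{S}$, and that $\lambda_2\in L^\infty(\mathcal{S},\mu)$. Then \[ \lim_{n\to\infty}\mathbb{P}\bigl(G(n,\kappa)\text{ is connected}\bigr)=\begin{cases}0&\text{if }\lambda_*<1,\\ 1&\text{if }\lambda_*>1.\end{cases} \]
   Context: Let $X_1,\dots,X_n$ be independent $\mu$-distributed random points of $\mathcal{S}$ and $p_n=\log n/n$. The random graph $G(n,\kappa)=(V_n,E_n)$ has vertex set $V_n=\{1,\dots,n\}$; given $X_1,\dots,X_n$, each pair $i\ne j$ is joined by an edge independently with probability $p_{ij}=\min\{1,\kappa(X_i,X_j)p_n\}$. $\lambda(x)=\int_{\mathcal{S}}\kappa(x,y)\,d\mu(y)$, $\lambda_2(x)=\left(\int_{\mathcal{S}}\kappa(x,y)^2\,d\mu(y)\right)^{1/2}$, and $\lambda_*=\operatorname{ess\,inf}_{x}\lambda(x)$ (essential infimum with respect to $\mu$). The kernel $\kappa$ is reducible if there is a measurable set $\mathcal{A}\subset\mathcal{S}$ with $0<\mu(\mathcal{A})<1$ such that $\kappa=0$ $(\mu\otimes\mu)$-almost everywhere on $\mathcal{A}\times\mathcal{A}^c$; otherwise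 $\kappa$ is irreducible. *)

theory Defs
  imports "HOL-Probability.Probability"
begin

section \<open>Graphs on a finite vertex set\<close>

text \<open>A simple graph is a pair \<open>(V, E)\<close>, with every edge a two-element set of vertices.\<close>

type_synonym 'v graph = "'v set \<times> 'v set set"

definition adjacent :: "'v graph \<Rightarrow> ('v \<times> 'v) set" where
  "adjacent G = {(u, v). {u, v} \<in> snd G}"

definition graph_connected :: "'v graph \<Rightarrow> bool" where
  "graph_connected G \<longleftrightarrow> (\<forall>u\<in>fst G. \<forall>v\<in>fst G. (u, v) \<in> (adjacent G)\<^sup>*)"

section \<open>Kernels\<close>

definition reducible :: "'a measure \<Rightarrow> ('a \<Rightarrow> 'a \<Rightarrow> real) \<Rightarrow> bool" where
  "reducible M \<kappa> \<longleftrightarrow>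
     (\<exists>A\<in>sets M. 0 < measure M A \<and> measure M A < 1 \<and>
        (AE (x, y) in M \<Otimes>\<^sub>M M. (x, y) \<in> A \<times> (space M - A) \<longrightarrow> \<kappa> x y = 0))"

abbreviation irreducible_kernel :: "'a measure \<Rightarrow> ('a \<Rightarrow> 'a \<Rightarrow> real) \<Rightarrow> bool" where
  "irreducible_kernel M \<kappa> \<equiv> \<not> reducible M \<kappa>"

text \<open>The integrals below are taken in the extended nonnegative reals: for some \<open>x\<close> they may be
  infinite, whereas the Bochner integral of a non-integrable function is \<open>0\<close> by convention.\<close>

definition lambda :: "'a measure \<Rightarrow> ('a \<Rightarrow> 'a \<Rightarrow> real) \<Rightarrow> 'a \<Rightarrow> ennreal" where
  "lambda M \<kappa> x = (\<integral>\<^sup>+ y. ennreal (\<kappa> x y) \<partial>M)"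

definition ennreal_sqrt :: "ennreal \<Rightarrow> ennreal" where
  "ennreal_sqrt t = (if t = \<infinity> then \<infinity> else ennreal (sqrt (enn2real t)))"

definition lambda2 :: "'a measure \<Rightarrow> ('a \<Rightarrow> 'a \<Rightarrow> real) \<Rightarrow> 'a \<Rightarrow> ennreal" where
  "lambda2 M \<kappa> x = ennreal_sqrt (\<integral>\<^sup>+ y. ennreal ((\<kappa> x y)\<^sup>2) \<partial>M)"

lemma measurable_lambda2:
  assumes "sigma_finite_measure M" and "(\<lambda>(x, y). \<kappa> x y) \<in> borel_measurable (M \<Otimes>\<^sub>M M)"
  shows "lambda2 M \<kappa> \<in> borel_measurable M"
proof -
  interpret sigma_finite_measure M by fact
  have "(\<lambda>(x, y). ennreal ((\<kappa> x y)\<^sup>2)) \<in> borel_measurable (M \<Otimes>\<^sub>M M)"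
    using assms(2) by (simp add: case_prod_beta)
  then have [measurable]: "(\<lambda>x. \<integral>\<^sup>+ y. ennreal ((\<kappa> x y)\<^sup>2) \<partial>M) \<in> borel_measurable M"
    by (rule borel_measurable_nn_integral)
  show ?thesis
    unfolding lambda2_def ennreal_sqrt_def by measurable
qed

definition essinf :: "'a measure \<Rightarrow> ('a \<Rightarrow> ennreal) \<Rightarrow> ennreal" where
  "essinf M f = Sup {c. AE x in M. c \<le> f x}"

definition lambda_star :: "'a measure \<Rightarrow> ('a \<Rightarrow> 'a \<Rightarrow> real) \<Rightarrow> ennreal" where
  "lambda_star M \<kappa> = essinf M (lambda M \<kappa>)"

section \<open>The random graph\<close>

definition edge_prob :: "('a \<Rightarrow> 'a \<Rightarrow> real) \<Rightarrow> nat \<Rightarrow> (nat \<Rightarrow> 'a) \<Rightarrow> nat \<times> nat \<Rightarrow> real" where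
  "edge_prob \<kappa> n X = (\<lambda>(i, j). min 1 (\<kappa> (X i) (X j) * (ln (real n) / real n)))"

definition vertex_pairs :: "nat \<Rightarrow> (nat \<times> nat) set" where
  "vertex_pairs n = {(i, j). 1 \<le> i \<and> i < j \<and> j \<le> n}"

definition graph_of :: "nat \<Rightarrow> (nat \<times> nat \<Rightarrow> bool) \<Rightarrow> nat graph" where
  "graph_of n b = ({1..n}, {{i, j} | i j. (i, j) \<in> vertex_pairs n \<and> b (i, j)})"

text \<open>The law of the graph for given positions \<open>X\<close>: one independent coin per pair of vertices.\<close>

definition graph_pmf :: "('a \<Rightarrow> 'a \<Rightarrow> real) \<Rightarrow> nat \<Rightarrow> (nat \<Rightarrow> 'a) \<Rightarrow> nat graph pmf" where
  "graph_pmf \<kappa> n X =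
     map_pmf (graph_of n) (Pi_pmf (vertex_pairs n) False (\<lambda>e. bernoulli_pmf (edge_prob \<kappa> n X e)))"

text \<open>The law of the random graph: the positions \<open>X 1, \<dots>, X n\<close> are independent with law \<open>M\<close>,
  and \<open>graph_pmf\<close> is the conditional law of the graph given \<open>X\<close>.\<close>

definition random_graph :: "'a measure \<Rightarrow> ('a \<Rightarrow> 'a \<Rightarrow> real) \<Rightarrow> nat \<Rightarrow> nat graph measure" where
  "random_graph M \<kappa> n =
     (\<Pi>\<^sub>M i\<in>{1..n}. M) \<bind> (\<lambda>X. measure_pmf (graph_pmf \<kappa> n X))"

text \<open>The kernel in this composition is measurable, so \<^const>\<open>random_graph\<close> is the intended mixture
  and not a default value of \<^const>\<open>bind\<close>.\<close>

lemma finite_vertex_pairs [simp]: "finite (vertex_pairs n)"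
  by (rule finite_subset[of _ "{1..n} \<times> {1..n}"]) (auto simp: vertex_pairs_def)

lemma pmf_bernoulli_clamp: "pmf (bernoulli_pmf p) b = (if b then min 1 (max 0 p) else 1 - min 1 (max 0 p))"
  by (simp add: bernoulli_pmf.rep_eq)

lemma measurable_edge_prob:
  assumes "(\<lambda>(x, y). \<kappa> x y) \<in> borel_measurable (M \<Otimes>\<^sub>M M)" and "e \<in> vertex_pairs n"
  shows "(\<lambda>X. edge_prob \<kappa> n X e) \<in> borel_measurable (\<Pi>\<^sub>M i\<in>{1..n}. M)"
proof -
  obtain i j where e: "e = (i, j)" "i \<in> {1..n}" "j \<in> {1..n}"
    using assms(2) by (auto simp: vertex_pairs_def)
  have "(\<lambda>X. (X i, X j)) \<in> (\<Pi>\<^sub>M i\<in>{1..n}. M) \<rightarrow>\<^sub>M M \<Otimes>\<^sub>M M"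
    using e by (intro measurable_Pair measurable_component_singleton)
  from measurable_compose[OF this assms(1)]
  have "(\<lambda>X. \<kappa> (X i) (X j)) \<in> borel_measurable (\<Pi>\<^sub>M i\<in>{1..n}. M)"
    by simp
  then show ?thesis
    unfolding e(1) edge_prob_def prod.case by (intro borel_measurable_min borel_measurable_times) auto
qed

lemma measurable_graph_pmf:
  assumes "(\<lambda>(x, y). \<kappa> x y) \<in> borel_measurable (M \<Otimes>\<^sub>M M)"
  shows "(\<lambda>X. measure_pmf (graph_pmf \<kappa> n X))
           \<in> (\<Pi>\<^sub>M i\<in>{1..n}. M) \<rightarrow>\<^sub>M subprob_algebra (count_space UNIV)"
proof (rule measurable_subprob_algebra)
  fix A :: "nat graph set"
  let ?D = "PiE_dflt (vertex_pairs n) False (\<lambda>_. UNIV :: bool set)"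
  let ?B = "graph_of n -` A"
  let ?P = "\<lambda>X. Pi_pmf (vertex_pairs n) False (\<lambda>e. bernoulli_pmf (edge_prob \<kappa> n X e))"
  have fin: "finite ?D" by (intro finite_PiE_dflt) auto
  have "emeasure (measure_pmf (graph_pmf \<kappa> n X)) A =
          ennreal (\<Sum>b\<in>?B \<inter> ?D. \<Prod>e\<in>vertex_pairs n. pmf (bernoulli_pmf (edge_prob \<kappa> n X e)) (b e))" for X
  proof -
    have "set_pmf (?P X) \<subseteq> ?D"
      using set_Pi_pmf_subset'[OF finite_vertex_pairs] by (fastforce simp: PiE_dflt_def)
    then have "measure_pmf.prob (?P X) ?B = measure_pmf.prob (?P X) (?B \<inter> ?D)"
      by (intro measure_pmf.finite_measure_eq_AE AE_pmfI) auto
    also have "\<dots> = (\<Sum>b\<in>?B \<inter> ?D. pmf (?P X) b)"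
      using fin by (intro measure_measure_pmf_finite) auto
    also have "\<dots> = (\<Sum>b\<in>?B \<inter> ?D. \<Prod>e\<in>vertex_pairs n. pmf (bernoulli_pmf (edge_prob \<kappa> n X e)) (b e))"
      by (intro sum.cong refl pmf_Pi') (auto simp: PiE_dflt_def)
    finally show ?thesis
      by (simp add: graph_pmf_def measure_pmf.emeasure_eq_measure)
  qed
  moreover have "(\<lambda>X. pmf (bernoulli_pmf (edge_prob \<kappa> n X e)) c)
      \<in> borel_measurable (\<Pi>\<^sub>M i\<in>{1..n}. M)" if "e \<in> vertex_pairs n" for e c
    using measurable_edge_prob[OF assms that] unfolding pmf_bernoulli_clamp by (cases c) simp_all
  ultimately show "(\<lambda>X. emeasure (measure_pmf (graph_pmf \<kappa> n X)) A)
      \<in> borel_measurable (\<Pi>\<^sub>M i\<in>{1..n}. M)"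
    by (simp add: borel_measurable_sum borel_measurable_prod)
qed (auto intro: prob_space_imp_subprob_space measure_pmf.prob_space_axioms)

lemma emeasure_random_graph:
  assumes "prob_space M" and "(\<lambda>(x, y). \<kappa> x y) \<in> borel_measurable (M \<Otimes>\<^sub>M M)"
  shows "emeasure (random_graph M \<kappa> n) A =
           (\<integral>\<^sup>+ X. emeasure (measure_pmf (graph_pmf \<kappa> n X)) A \<partial>(\<Pi>\<^sub>M i\<in>{1..n}. M))"
proof -
  interpret prob_space "\<Pi>\<^sub>M i\<in>{1..n}. M"
    using assms(1) by (intro prob_space_PiM)
  show ?thesis
    unfolding random_graph_def
    by (rule emeasure_bind[OF not_empty measurable_graph_pmf[OF assms(2)]]) simp
qed

end

theory Submission
  imports Defs "HOL-Real_Asymp.Real_Asymp"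
begin

text \<open>Write \<open>p = ln n / n\<close>. If \<open>\<lambda>\<^sub>* < c < 1\<close>, the number \<open>N\<close> of isolated vertices with position in
  \<open>{\<lambda> < c}\<close> has mean of order at least \<open>n\<^bsup>1 - c\<^esup>\<close>, and the bound on \<open>\<lambda>\<^sub>2\<close> makes distinct vertices
  asymptotically uncorrelated, so \<open>N > 0\<close> with high probability by Chebyshev's inequality.

  If \<open>\<lambda>\<^sub>* > 1\<close>, a union bound over vertex sets \<open>S\<close> without edges to the complement is used. For
  \<open>|S| \<le> \<epsilon> n\<close> the expectation over all positions is estimated: given the positions in \<open>S\<close>, the outside
  vertices are independent, and each avoids \<open>S\<close> with probability at most
  \<open>1 - (1 + \<eta>) p |S|\<close> as long as \<open>p |S|\<close> is small. When \<open>S\<close> and its complement both have more than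
  \<open>\<epsilon> n\<close> elements, continuity and irreducibility give finitely many open sets, of total mass close
  to 1, connected through pairs on whose product \<open>\<kappa>\<close> is bounded away from 0. For some such pair
  \<open>(A, B)\<close> there are linearly many vertices of \<open>S\<close> in \<open>A\<close> and of the complement in \<open>B\<close>. All these
  potential edges are absent with probability \<open>exp (- \<Omega>(n ln n))\<close>, which beats the \<open>2\<^sup>n\<close> choices
  of \<open>S\<close>.\<close>

section \<open>Cuts\<close>

text \<open>The two ranges of \<open>S\<close> are averaged differently. For small \<open>S\<close>
  the positions are averaged together with the coins, because only the integrated degree is bounded
  from below, not the degrees in a given sample. For \<open>S\<close> of linear size this average
  may be too weak: that some set of the open system is nearly empty of vertices can have probability
  no smaller than \<open>exp (- O(n))\<close>, which need not beat the \<open>2 ^ n\<close> choices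
  of \<open>S\<close>. Atypical positions are therefore discarded once, before summing over
  \<open>S\<close>, and the remaining estimate is uniform in the positions.

  The bound on \<lambda>_2 enters at second order. Truncation by \<open>min 1\<close> costs at most
  \<open>C * p\<^sup>2\<close> in a mean link probability, which is negligible against
  \<open>p\<close>. Expanding a product of \<open>k\<close> non-adjacency factors costs about
  \<open>C * (k * p)\<^sup>2 / 2\<close>, which is negligible against \<open>k * p\<close> only if
  \<open>k * p\<close> is small; hence a larger \<open>S\<close> is thinned to about
  \<open>\<delta> / p\<close> of its vertices.\<close>

definition cut_pairs :: "nat \<Rightarrow> nat set \<Rightarrow> (nat \<times> nat) set" where
  "cut_pairs n S = {(i, j) \<in> vertex_pairs n. (i \<in> S) \<noteq> (j \<in> S)}"

lemma cut_pairs_subset: "cut_pairs n S \<subseteq> vertex_pairs n"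
  by (auto simp: cut_pairs_def)

lemma cut_pairs_complement: "cut_pairs n ({1..n} - S) = cut_pairs n S"
  by (auto simp: cut_pairs_def vertex_pairs_def)

text \<open>The witness is the component of a vertex \<open>u\<close> that fails to reach some
  \<open>v\<close>: an open crossing pair would enlarge it.\<close>

lemma not_connected_imp_cut:
  assumes "\<not> graph_connected (graph_of n b)"
  obtains S where "S \<subseteq> {1..n}" "S \<noteq> {}" "S \<noteq> {1..n}" "\<forall>e\<in>cut_pairs n S. \<not> b e"
proof -
  let ?G = "graph_of n b"
  from assms obtain u v where uv: "u \<in> {1..n}" "v \<in> {1..n}" "(u, v) \<notin> (adjacent ?G)\<^sup>*"
    by (auto simp: graph_connected_def graph_of_def)
  define S where "S = {w\<in>{1..n}. (u, w) \<in> (adjacent ?G)\<^sup>*}"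
  have adj: "(i, j) \<in> adjacent ?G \<and> (j, i) \<in> adjacent ?G" if "(i, j) \<in> vertex_pairs n" "b (i, j)" for i j
    using that by (auto simp: adjacent_def graph_of_def insert_commute)
  have "\<not> b e" if e: "e \<in> cut_pairs n S" for e
  proof
    assume "b e"
    obtain i j where ij: "e = (i, j)" by force
    with e have v: "(i, j) \<in> vertex_pairs n" "(i \<in> S) \<noteq> (j \<in> S)" by (auto simp: cut_pairs_def)
    then have "i \<in> {1..n}" "j \<in> {1..n}" by (auto simp: vertex_pairs_def)
    with adj[OF v(1)] \<open>b e\<close> v(2) ij show False
      by (auto simp: S_def intro: rtrancl_into_rtrancl)
  qed
  moreover have "u \<in> S" "v \<notin> S" "S \<subseteq> {1..n}"
    using uv by (auto simp: S_def)
  ultimately show thesis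
    using uv that[of S] by blast
qed

text \<open>A one-vertex graph is connected although its vertex is isolated, hence
  \<open>n \<ge> 2\<close>. A path to a second vertex would begin with an open crossing pair of
  \<open>{i}\<close>.\<close>

lemma isolated_not_connected:
  assumes "n \<ge> 2" "i \<in> {1..n}" "\<forall>e\<in>cut_pairs n {i}. \<not> b e"
  shows "\<not> graph_connected (graph_of n b)"
proof
  assume conn: "graph_connected (graph_of n b)"
  obtain j where j: "j \<in> {1..n}" "j \<noteq> i"
  proof (cases "i = 1")
    case True
    with assms(1) show ?thesis by (intro that[of 2]) auto
  next
    case False
    with assms(1) show ?thesis by (intro that[of 1]) auto
  qed
  with conn assms(2) have "(i, j) \<in> (adjacent (graph_of n b))\<^sup>*"
    by (auto simp: graph_connected_def graph_of_def)
  with j(2) obtain k where k: "(i, k) \<in> adjacent (graph_of n b)"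
    by (metis converse_rtranclE)
  then obtain a c where ac: "{i, k} = {a, c}" "(a, c) \<in> vertex_pairs n" "b (a, c)"
    by (auto simp: adjacent_def graph_of_def)
  then have "a \<noteq> c" "a = i \<or> c = i" by (auto simp: vertex_pairs_def doubleton_eq_iff)
  with ac have "(a, c) \<in> cut_pairs n {i}" by (auto simp: cut_pairs_def)
  with assms(3) ac(3) show False by blast
qed

text \<open>Pairs are ordered by index, not by side of the cut; symmetry of \<open>f\<close> allows
  the inside vertex to be put first. With the outside vertex as outer index, the factors for
  different \<open>j\<close> depend on different outside positions.\<close>

lemma prod_cut_pairs:
  fixes f :: "nat \<Rightarrow> nat \<Rightarrow> 'b::comm_monoid_mult"
  assumes "\<And>i j. f i j = f j i" and S: "S \<subseteq> {1..n}"
  shows "(\<Prod>(i, j)\<in>cut_pairs n S. f i j) = (\<Prod>j\<in>{1..n} - S. \<Prod>i\<in>S. f i j)"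
proof -
  have fin: "finite S" using S finite_subset by blast
  have "(\<Prod>(i, j)\<in>cut_pairs n S. f i j) = (\<Prod>(j, i)\<in>({1..n} - S) \<times> S. f i j)"
  proof (rule prod.reindex_bij_witness[where
          i = "\<lambda>(j, i). if i < j then (i, j) else (j, i)" and
          j = "\<lambda>(i, j). if i \<in> S then (j, i) else (i, j)"], goal_cases)
    case (4 b)
    obtain j i where b: "b = (j, i)" by force
    with 4 have "i \<noteq> j" by auto
    with 4 b S show ?case by (cases "i < j") (auto simp: cut_pairs_def vertex_pairs_def)
  qed (use S assms(1) in \<open>auto simp: cut_pairs_def vertex_pairs_def split: if_splits\<close>)
  also have "\<dots> = (\<Prod>j\<in>{1..n} - S. \<Prod>i\<in>S. f i j)"
    by (subst prod.cartesian_product) simp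
  finally show ?thesis .
qed

text \<open>The pair formed by \<open>i\<close> and \<open>j\<close> itself is missing on the left.
  Ignoring it turns joint isolation into a cut event, at the price of one factor at most 1.\<close>

lemma cut_pairs_two_subset: "cut_pairs n {i, j} \<subseteq> cut_pairs n {i} \<union> cut_pairs n {j}"
  by (auto simp: cut_pairs_def)

section \<open>The graph given the positions\<close>

definition link_prob :: "('a \<Rightarrow> 'a \<Rightarrow> real) \<Rightarrow> nat \<Rightarrow> 'a \<Rightarrow> 'a \<Rightarrow> real" where
  "link_prob \<kappa> n x y = min 1 (\<kappa> x y * (ln (real n) / real n))"

text \<open>The conditional probability, given the positions, that no edge joins \<open>S\<close> to
  its complement.\<close>

definition cut_prob :: "('a \<Rightarrow> 'a \<Rightarrow> real) \<Rightarrow> nat \<Rightarrow> nat set \<Rightarrow> (nat \<Rightarrow> 'a) \<Rightarrow> real" where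
  "cut_prob \<kappa> n S X = (\<Prod>j\<in>{1..n} - S. \<Prod>i\<in>S. 1 - link_prob \<kappa> n (X i) (X j))"

definition edge_pmf :: "('a \<Rightarrow> 'a \<Rightarrow> real) \<Rightarrow> nat \<Rightarrow> (nat \<Rightarrow> 'a) \<Rightarrow> (nat \<times> nat \<Rightarrow> bool) pmf" where
  "edge_pmf \<kappa> n X = Pi_pmf (vertex_pairs n) False (\<lambda>e. bernoulli_pmf (edge_prob \<kappa> n X e))"

lemma ln_div_nonneg: "0 \<le> ln (real n) / real n"
  by (cases "n = 0") auto

lemma link_prob_le_1: "link_prob \<kappa> n x y \<le> 1"
  by (simp add: link_prob_def)

lemma link_prob_nonneg: "0 \<le> \<kappa> x y \<Longrightarrow> 0 \<le> link_prob \<kappa> n x y"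
  unfolding link_prob_def using ln_div_nonneg[of n] by (metis mult_nonneg_nonneg min.boundedI zero_le_one)

lemma cut_prob_nonneg: "0 \<le> cut_prob \<kappa> n S X"
  unfolding cut_prob_def by (intro prod_nonneg) (simp add: link_prob_le_1)

lemma prob_graph_pmf:
  "measure_pmf.prob (graph_pmf \<kappa> n X) A = measure_pmf.prob (edge_pmf \<kappa> n X) {b. graph_of n b \<in> A}"
  by (simp add: graph_pmf_def edge_pmf_def vimage_def)

lemma prob_no_edges:
  assumes "\<And>x y. 0 \<le> \<kappa> x y" "D \<subseteq> vertex_pairs n"
  shows "measure_pmf.prob (edge_pmf \<kappa> n X) {b. \<forall>e\<in>D. \<not> b e}
       = (\<Prod>(i, j)\<in>D. 1 - link_prob \<kappa> n (X i) (X j))"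
proof -
  \<comment> \<open>Written as a box, the event has a product probability; coordinates outside
    \<open>D\<close> are free and contribute 1.\<close>
  have "{b. \<forall>e\<in>D. \<not> b e} = Pi (vertex_pairs n) (\<lambda>e. if e \<in> D then {False} else UNIV)"
    using assms(2) by (auto simp: Pi_def split: if_splits)
  then have "measure_pmf.prob (edge_pmf \<kappa> n X) {b. \<forall>e\<in>D. \<not> b e}
     = (\<Prod>e\<in>vertex_pairs n. measure_pmf.prob (bernoulli_pmf (edge_prob \<kappa> n X e)) (if e \<in> D then {False} else UNIV))"
    unfolding edge_pmf_def by (simp add: measure_Pi_pmf_Pi)
  also have "\<dots> = (\<Prod>e\<in>vertex_pairs n. if e \<in> D then (case e of (i, j) \<Rightarrow> 1 - link_prob \<kappa> n (X i) (X j)) else 1)"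
  proof (intro prod.cong refl)
    fix e :: "nat \<times> nat"
    obtain i j where e: "e = (i, j)" by force
    have "edge_prob \<kappa> n X e = link_prob \<kappa> n (X i) (X j)"
      by (simp add: e edge_prob_def link_prob_def)
    then show "measure_pmf.prob (bernoulli_pmf (edge_prob \<kappa> n X e)) (if e \<in> D then {False} else UNIV)
        = (if e \<in> D then (case e of (i, j) \<Rightarrow> 1 - link_prob \<kappa> n (X i) (X j)) else 1)"
      using link_prob_le_1[of \<kappa> n "X i" "X j"] link_prob_nonneg[of \<kappa> "X i" "X j" n] assms(1)
      by (auto simp: e measure_pmf_single)
  qed
  also have "\<dots> = (\<Prod>(i, j)\<in>D. 1 - link_prob \<kappa> n (X i) (X j))"
    using assms(2) by (simp add: prod.If_cases Int_absorb1)
  finally show ?thesis .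
qed

lemma prob_cut_pairs_empty:
  assumes "\<And>x y. 0 \<le> \<kappa> x y" "\<And>x y. \<kappa> x y = \<kappa> y x" "S \<subseteq> {1..n}"
  shows "measure_pmf.prob (edge_pmf \<kappa> n X) {b. \<forall>e\<in>cut_pairs n S. \<not> b e} = cut_prob \<kappa> n S X"
  using prod_cut_pairs[of "\<lambda>i j. 1 - link_prob \<kappa> n (X i) (X j)" S n] assms
  by (simp add: prob_no_edges cut_pairs_subset cut_prob_def link_prob_def)

lemma prob_two_isolated_le:
  assumes "\<And>x y. 0 \<le> \<kappa> x y" "\<And>x y. \<kappa> x y = \<kappa> y x" "i \<in> {1..n}" "j \<in> {1..n}"
  shows "measure_pmf.prob (edge_pmf \<kappa> n X) {b. (\<forall>e\<in>cut_pairs n {i}. \<not> b e) \<and> (\<forall>e\<in>cut_pairs n {j}. \<not> b e)}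
           \<le> cut_prob \<kappa> n {i, j} X"
proof -
  have "measure_pmf.prob (edge_pmf \<kappa> n X) {b. (\<forall>e\<in>cut_pairs n {i}. \<not> b e) \<and> (\<forall>e\<in>cut_pairs n {j}. \<not> b e)}
     \<le> measure_pmf.prob (edge_pmf \<kappa> n X) {b. \<forall>e\<in>cut_pairs n {i, j}. \<not> b e}"
    using cut_pairs_two_subset by (intro measure_pmf.finite_measure_mono) (auto, blast)
  with assms show ?thesis
    by (simp add: prob_cut_pairs_empty)
qed

text \<open>Both sides of a cut have the same crossing pairs, so \<open>F\<close> has to contain
  only one of them. This is what restricts the small case to the smaller side.\<close>

lemma prob_not_connected_le:
  assumes "\<And>x y. 0 \<le> \<kappa> x y" "\<And>x y. \<kappa> x y = \<kappa> y x"
    and F: "\<And>S. S \<subseteq> {1..n} \<Longrightarrow> S \<noteq> {} \<Longrightarrow> S \<noteq> {1..n} \<Longrightarrow> S \<in> F \<or> {1..n} - S \<in> F"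
    and sub: "F \<subseteq> Pow {1..n}"
  shows "measure_pmf.prob (graph_pmf \<kappa> n X) {G. \<not> graph_connected G} \<le> (\<Sum>S\<in>F. cut_prob \<kappa> n S X)"
proof -
  have fin: "finite F" using sub finite_subset by blast
  have "{b. graph_of n b \<in> {G. \<not> graph_connected G}} \<subseteq> (\<Union>S\<in>F. {b. \<forall>e\<in>cut_pairs n S. \<not> b e})"
  proof
    fix b assume "b \<in> {b. graph_of n b \<in> {G. \<not> graph_connected G}}"
    then obtain S where S: "S \<subseteq> {1..n}" "S \<noteq> {}" "S \<noteq> {1..n}" "\<forall>e\<in>cut_pairs n S. \<not> b e"
      using not_connected_imp_cut[of n b] by auto
    from F[OF S(1-3)] show "b \<in> (\<Union>S\<in>F. {b. \<forall>e\<in>cut_pairs n S. \<not> b e})"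
    proof
      assume "{1..n} - S \<in> F"
      moreover have "b \<in> {b. \<forall>e\<in>cut_pairs n ({1..n} - S). \<not> b e}"
        using S(4) by (simp only: cut_pairs_complement) simp
      ultimately show ?thesis by blast
    qed (use S(4) in blast)
  qed
  then have "measure_pmf.prob (graph_pmf \<kappa> n X) {G. \<not> graph_connected G}
      \<le> measure_pmf.prob (edge_pmf \<kappa> n X) (\<Union>S\<in>F. {b. \<forall>e\<in>cut_pairs n S. \<not> b e})"
    unfolding prob_graph_pmf by (intro measure_pmf.finite_measure_mono) auto
  also have "\<dots> \<le> (\<Sum>S\<in>F. measure_pmf.prob (edge_pmf \<kappa> n X) {b. \<forall>e\<in>cut_pairs n S. \<not> b e})"
    using fin by (intro measure_pmf.finite_measure_subadditive_finite) auto
  also have "\<dots> = (\<Sum>S\<in>F. cut_prob \<kappa> n S X)"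
    using sub assms(1,2) by (intro sum.cong refl prob_cut_pairs_empty) auto
  finally show ?thesis .
qed

text \<open>Chebyshev's inequality for given positions, kept linear in the moments and with a free
  centring constant \<open>m\<close>. It can thus be integrated over the positions afterwards, with
  \<open>m\<close> the unconditional mean. The weights \<open>w\<close> select the vertices whose
  position lies in a prescribed set.\<close>

lemma prob_connected_second_moment:
  fixes w :: "nat \<Rightarrow> real"
  assumes "\<And>x y. 0 \<le> \<kappa> x y" "\<And>x y. \<kappa> x y = \<kappa> y x" "n \<ge> 2" "m > 0"
    and w: "\<And>i. w i \<in> {0, 1}"
  shows "measure_pmf.prob (graph_pmf \<kappa> n X) {G. graph_connected G}
     \<le> 1 - 2 / m * (\<Sum>i\<in>{1..n}. w i * cut_prob \<kappa> n {i} X)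
       + 1 / m\<^sup>2 * (\<Sum>i\<in>{1..n}. w i * cut_prob \<kappa> n {i} X)
       + 1 / m\<^sup>2 * (\<Sum>i\<in>{1..n}. \<Sum>j\<in>{1..n} - {i}. w i * w j * cut_prob \<kappa> n {i, j} X)"
proof -
  let ?P = "measure_pmf (edge_pmf \<kappa> n X)"
  define I where "I i b = (indicator {b. \<forall>e\<in>cut_pairs n {i}. \<not> b e} b :: real)" for i b
  define N where "N b = (\<Sum>i\<in>{1..n}. w i * I i b)" for b
  have int: "integrable ?P f" if "\<And>b. \<bar>f b\<bar> \<le> B" for f :: "_ \<Rightarrow> real" and B
    using that by (intro measure_pmf.integrable_const_bound[where B = B]) auto
  have I01: "I i b \<in> {0, 1}" for i b by (auto simp: I_def indicator_def)
  have intI: "integrable ?P (I i)" for i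
    by (rule int[of _ 1]) (simp add: I_def indicator_def)
  have intII: "integrable ?P (\<lambda>b. I i b * I j b)" for i j
    by (rule int[of _ 1]) (simp add: I_def indicator_def)
  have EI: "(\<integral>b. I i b \<partial>?P) = cut_prob \<kappa> n {i} X" if "i \<in> {1..n}" for i
    using that assms(1,2) unfolding I_def by (simp add: prob_cut_pairs_empty)
  have EII: "(\<integral>b. I i b * I j b \<partial>?P) \<le> cut_prob \<kappa> n {i, j} X" if "i \<in> {1..n}" "j \<in> {1..n}" for i j
  proof -
    have "(\<integral>b. I i b * I j b \<partial>?P) =
       (\<integral>b. indicator {b. (\<forall>e\<in>cut_pairs n {i}. \<not> b e) \<and> (\<forall>e\<in>cut_pairs n {j}. \<not> b e)} b \<partial>?P)"
      by (intro Bochner_Integration.integral_cong) (auto simp: I_def indicator_def)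
    with prob_two_isolated_le[of \<kappa> i n j X] that assms(1,2) show ?thesis by simp
  qed
  \<comment> \<open>Weights and indicators are 0 or 1, so the diagonal of the square is
    \<open>N b\<close> itself.\<close>
  have N2: "(N b)\<^sup>2 = (\<Sum>i\<in>{1..n}. w i * I i b) + (\<Sum>i\<in>{1..n}. \<Sum>j\<in>{1..n} - {i}. w i * w j * (I i b * I j b))" for b
  proof -
    have "(N b)\<^sup>2 = (\<Sum>i\<in>{1..n}. \<Sum>j\<in>{1..n}. (w i * I i b) * (w j * I j b))"
      by (simp add: N_def power2_eq_square sum_product)
    also have "\<dots> = (\<Sum>i\<in>{1..n}. w i * I i b + (\<Sum>j\<in>{1..n} - {i}. w i * w j * (I i b * I j b)))"
    proof (intro sum.cong refl)
      fix i assume i: "i \<in> {1..n}"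
      have "(\<Sum>j\<in>{1..n}. (w i * I i b) * (w j * I j b))
          = (w i * I i b) * (w i * I i b) + (\<Sum>j\<in>{1..n} - {i}. (w i * I i b) * (w j * I j b))"
        using i by (intro sum.remove) auto
      moreover have "(w i * I i b) * (w i * I i b) = w i * I i b"
        using w[of i] I01[of i b] by auto
      ultimately show "(\<Sum>j\<in>{1..n}. (w i * I i b) * (w j * I j b))
          = w i * I i b + (\<Sum>j\<in>{1..n} - {i}. w i * w j * (I i b * I j b))"
        by (simp add: mult_ac)
    qed
    finally show ?thesis by (simp add: sum.distrib)
  qed
  have "measure_pmf.prob (graph_pmf \<kappa> n X) {G. graph_connected G}
      = (\<integral>b. indicator {b. graph_connected (graph_of n b)} b \<partial>?P)"
    by (simp add: prob_graph_pmf)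
  also have "\<dots> \<le> (\<integral>b. 1 - 2 / m * N b + 1 / m\<^sup>2 * (N b)\<^sup>2 \<partial>?P)"
  proof (rule integral_mono)
    show "integrable ?P (\<lambda>b. 1 - 2 / m * N b + 1 / m\<^sup>2 * (N b)\<^sup>2)"
      unfolding N2 by (auto simp: N_def intro!: Bochner_Integration.integrable_add Bochner_Integration.integrable_diff
          Bochner_Integration.integrable_sum Bochner_Integration.integrable_mult_right intI intII)
    \<comment> \<open>The right side is \<open>(1 - N b / m)\<^sup>2\<close>: it equals 1 if no
      vertex is isolated and is nonnegative in any case.\<close>
    show "indicator {b. graph_connected (graph_of n b)} b \<le> 1 - 2 / m * N b + 1 / m\<^sup>2 * (N b)\<^sup>2" for b
    proof (cases "graph_connected (graph_of n b)")
      case True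
      then have "N b = 0"
        using isolated_not_connected[of n _ b] assms(3) unfolding N_def I_def
        by (intro sum.neutral ballI) (auto simp: indicator_def)
      then show ?thesis by simp
    next
      case False
      have "0 \<le> (1 - N b / m)\<^sup>2" by simp
      also have "\<dots> = 1 - 2 / m * N b + 1 / m\<^sup>2 * (N b)\<^sup>2"
        by (simp add: power2_eq_square algebra_simps)
      finally show ?thesis using False by simp
    qed
  qed (auto intro!: int[of _ 1])
  also have "\<dots> = 1 - 2 / m * (\<Sum>i\<in>{1..n}. w i * (\<integral>b. I i b \<partial>?P))
       + 1 / m\<^sup>2 * ((\<Sum>i\<in>{1..n}. w i * (\<integral>b. I i b \<partial>?P))
       + (\<Sum>i\<in>{1..n}. \<Sum>j\<in>{1..n} - {i}. w i * w j * (\<integral>b. I i b * I j b \<partial>?P)))"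
    unfolding N2 by (simp add: N_def intI intII)
  also have "\<dots> \<le> 1 - 2 / m * (\<Sum>i\<in>{1..n}. w i * cut_prob \<kappa> n {i} X)
       + 1 / m\<^sup>2 * ((\<Sum>i\<in>{1..n}. w i * cut_prob \<kappa> n {i} X)
       + (\<Sum>i\<in>{1..n}. \<Sum>j\<in>{1..n} - {i}. w i * w j * cut_prob \<kappa> n {i, j} X))"
  proof -
    have "w i \<ge> 0" for i using w[of i] by auto
    then have "(\<Sum>i\<in>{1..n}. \<Sum>j\<in>{1..n} - {i}. w i * w j * (\<integral>b. I i b * I j b \<partial>?P))
       \<le> (\<Sum>i\<in>{1..n}. \<Sum>j\<in>{1..n} - {i}. w i * w j * cut_prob \<kappa> n {i, j} X)"
      by (intro sum_mono mult_left_mono EII mult_nonneg_nonneg) auto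
    moreover have "(\<Sum>i\<in>{1..n}. w i * (\<integral>b. I i b \<partial>?P)) = (\<Sum>i\<in>{1..n}. w i * cut_prob \<kappa> n {i} X)"
      by (intro sum.cong refl) (simp add: EI)
    ultimately show ?thesis by (simp add: divide_right_mono)
  qed
  finally show ?thesis by (simp add: algebra_simps add_divide_distrib)
qed

declare One_nat_def [simp del]

section \<open>Integrating over the positions\<close>

lemma exp_minus_le_quadratic:
  fixes z :: real
  assumes "0 \<le> z"
  shows "exp (- z) \<le> 1 - z + z\<^sup>2 / 2"
proof -
  have A: "1 + z + z\<^sup>2 / 2 \<le> exp z"
    using assms by (rule exp_lower_Taylor_quadratic)
  have pos: "0 \<le> 1 - z + z\<^sup>2 / 2"
    using zero_le_power2[of "z - 1"] by (simp add: power2_eq_square algebra_simps)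
  \<comment> \<open>The quadratic Taylor polynomials at \<open>z\<close> and \<open>- z\<close>
    multiply to \<open>1 + z ^ 4 / 4\<close>, so the lower bound for \<open>exp z\<close> inverts to
    an upper bound for \<open>exp (- z)\<close>.\<close>
  have "1 \<le> 1 + z ^ 4 / 4" by simp
  also have "\<dots> = (1 - z + z\<^sup>2 / 2) * (1 + z + z\<^sup>2 / 2)"
    by (simp add: power2_eq_square power4_eq_xxxx algebra_simps)
  also have "\<dots> \<le> (1 - z + z\<^sup>2 / 2) * exp z"
    using A pos by (rule mult_left_mono)
  finally show ?thesis
    by (simp add: exp_minus field_simps)
qed

text \<open>A second-order Bonferroni bound whose mixed terms are removed by the Cauchy-Schwarz
  inequality. Only the separate second moments of the factors remain, and these are what \<lambda>_2
  controls.\<close>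

lemma prod_one_minus_le_quadratic:
  fixes l :: "'i \<Rightarrow> real"
  assumes "\<And>i. i \<in> T \<Longrightarrow> 0 \<le> l i" "\<And>i. i \<in> T \<Longrightarrow> l i \<le> 1"
  shows "(\<Prod>i\<in>T. 1 - l i) \<le> 1 - (\<Sum>i\<in>T. l i) + real (card T) / 2 * (\<Sum>i\<in>T. (l i)\<^sup>2)"
proof (cases "finite T")
  case True
  have "(\<Prod>i\<in>T. 1 - l i) \<le> (\<Prod>i\<in>T. exp (- l i))"
  proof (intro prod_mono conjI)
    fix i assume "i \<in> T"
    with assms(2) show "0 \<le> 1 - l i" by simp
    show "1 - l i \<le> exp (- l i)"
      using exp_ge_add_one_self[of "- l i"] by simp
  qed
  also have "\<dots> = exp (- (\<Sum>i\<in>T. l i))"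
    using True by (simp add: exp_sum sum_negf[symmetric])
  also have "\<dots> \<le> 1 - (\<Sum>i\<in>T. l i) + (\<Sum>i\<in>T. l i)\<^sup>2 / 2"
    using assms(1) by (intro exp_minus_le_quadratic sum_nonneg)
  also have "(\<Sum>i\<in>T. l i)\<^sup>2 \<le> real (card T) * (\<Sum>i\<in>T. (l i)\<^sup>2)"
    using sum_squared_le_sum_of_squares[of l T] True by (simp add: mult.commute)
  finally show ?thesis by simp
qed simp

lemma prod_le_prod_subset:
  fixes f :: "'i \<Rightarrow> 'b::linordered_idom"
  assumes "finite A" "B \<subseteq> A" "\<And>i. i \<in> A \<Longrightarrow> 0 \<le> f i" "\<And>i. i \<in> A \<Longrightarrow> f i \<le> 1"
  shows "prod f A \<le> prod f B"
proof -
  have "prod f A = prod f (A - B) * prod f B"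
    using assms(1,2) by (rule prod.subset_diff[rotated])
  also have "\<dots> \<le> 1 * prod f B"
    using assms by (intro mult_right_mono prod_le_1 prod_nonneg) auto
  finally show ?thesis by simp
qed

section \<open>Independent positions and Fubini's theorem\<close>

locale kernel_space = prob_space M for M :: "'a measure" +
  fixes \<kappa> :: "'a \<Rightarrow> 'a \<Rightarrow> real"
  assumes kernel_nonneg: "0 \<le> \<kappa> x y"
    and kernel_sym: "\<kappa> x y = \<kappa> y x"
    and kernel_measurable: "(\<lambda>(x, y). \<kappa> x y) \<in> borel_measurable (M \<Otimes>\<^sub>M M)"
begin

abbreviation positions :: "nat \<Rightarrow> (nat \<Rightarrow> 'a) measure" where
  "positions n \<equiv> \<Pi>\<^sub>M i\<in>{1..n}. M"

lemma prob_space_positions: "prob_space (positions n)"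
  by (intro prob_space_PiM prob_space_axioms)

lemma link_prob_measurable [measurable (raw)]:
  assumes "f \<in> measurable N M" "g \<in> measurable N M"
  shows "(\<lambda>x. link_prob \<kappa> n (f x) (g x)) \<in> borel_measurable N"
proof -
  have "(\<lambda>x. \<kappa> (f x) (g x)) \<in> borel_measurable N"
    using measurable_compose[OF measurable_Pair[OF assms] kernel_measurable] by simp
  then show ?thesis unfolding link_prob_def by measurable
qed

lemma link_bounds: "0 \<le> link_prob \<kappa> n x y" "link_prob \<kappa> n x y \<le> 1"
  by (simp_all add: link_prob_nonneg kernel_nonneg link_prob_le_1)

lemma cut_prob_measurable:
  assumes "S \<subseteq> {1..n}"
  shows "cut_prob \<kappa> n S \<in> borel_measurable (positions n)"
proof -
  have "(\<lambda>X. X i) \<in> measurable (positions n) M" if "i \<in> {1..n}" for i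
    using that by (rule measurable_component_singleton)
  with assms show ?thesis
    unfolding cut_prob_def[abs_def]
    by (intro borel_measurable_prod borel_measurable_diff borel_measurable_const link_prob_measurable) auto
qed

lemma cut_prob_le_1: "cut_prob \<kappa> n S X \<le> 1"
  unfolding cut_prob_def by (intro prod_le_1 conjI prod_nonneg) (auto simp: link_bounds)

lemma product_sigma_finite_const: "product_sigma_finite (\<lambda>_::nat. M)"
  by standard

text \<open>Fubini's theorem with the coordinates in \<open>S\<close> outermost: once they are
  frozen, the remaining factors are one function of independent, identically distributed positions,
  so their integral is a power.\<close>

lemma nn_integral_PiM_split:
  assumes fin: "finite S" "finite J" and dis: "S \<inter> J = {}"
    and H: "H \<in> borel_measurable (PiM S (\<lambda>_::nat. M))"
    and G: "(\<lambda>(x, y). G x y) \<in> borel_measurable (PiM S (\<lambda>_. M) \<Otimes>\<^sub>M M)"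
  shows "(\<integral>\<^sup>+X. H (restrict X S) * (\<Prod>j\<in>J. G (restrict X S) (X j)) \<partial>PiM (S \<union> J) (\<lambda>_. M))
       = (\<integral>\<^sup>+x. H x * (\<integral>\<^sup>+y. G x y \<partial>M) ^ card J \<partial>PiM S (\<lambda>_. M))"
proof -
  interpret product_sigma_finite "\<lambda>_::nat. M" by (rule product_sigma_finite_const)
  have r: "(\<lambda>X. restrict X S) \<in> measurable (PiM (S \<union> J) (\<lambda>_. M)) (PiM S (\<lambda>_. M))"
    by (rule measurable_restrict_subset) auto
  have Gm: "(\<lambda>X. G (restrict X S) (X j)) \<in> borel_measurable (PiM (S \<union> J) (\<lambda>_. M))" if "j \<in> J" for j
  proof -
    have "(\<lambda>X. (restrict X S, X j)) \<in> measurable (PiM (S \<union> J) (\<lambda>_. M)) (PiM S (\<lambda>_. M) \<Otimes>\<^sub>M M)"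
      using that r by (intro measurable_Pair) (auto intro: measurable_component_singleton)
    from measurable_compose[OF this G] show ?thesis by simp
  qed
  have "(\<lambda>X. H (restrict X S) * (\<Prod>j\<in>J. G (restrict X S) (X j))) \<in> borel_measurable (PiM (S \<union> J) (\<lambda>_. M))"
    using Gm measurable_compose[OF r H]
    by (intro borel_measurable_times_ennreal borel_measurable_prod_ennreal) auto
  then have "(\<integral>\<^sup>+X. H (restrict X S) * (\<Prod>j\<in>J. G (restrict X S) (X j)) \<partial>PiM (S \<union> J) (\<lambda>_. M))
     = (\<integral>\<^sup>+x. \<integral>\<^sup>+y. H (restrict (merge S J (x, y)) S) * (\<Prod>j\<in>J. G (restrict (merge S J (x, y)) S) (merge S J (x, y) j))
           \<partial>PiM J (\<lambda>_. M) \<partial>PiM S (\<lambda>_. M))"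
    using fin dis by (intro product_nn_integral_fold) auto
  also have "\<dots> = (\<integral>\<^sup>+x. H x * (\<integral>\<^sup>+y. G x y \<partial>M) ^ card J \<partial>PiM S (\<lambda>_. M))"
  proof (rule nn_integral_cong)
    fix x assume x: "x \<in> space (PiM S (\<lambda>_. M))"
    have Gx: "G x \<in> borel_measurable M"
      using measurable_Pair2[OF G x] by simp
    have "restrict (merge S J (x, y)) S = x" for y
      using x dis by (auto simp: space_PiM PiE_def extensional_restrict restrict_merge)
    moreover have "merge S J (x, y) j = y j" if "j \<in> J" for y j
      using that dis by (auto simp: merge_def)
    ultimately have "(\<integral>\<^sup>+y. H (restrict (merge S J (x, y)) S) *
          (\<Prod>j\<in>J. G (restrict (merge S J (x, y)) S) (merge S J (x, y) j)) \<partial>PiM J (\<lambda>_. M))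
        = (\<integral>\<^sup>+y. H x * (\<Prod>j\<in>J. G x (y j)) \<partial>PiM J (\<lambda>_. M))"
      by simp
    also have "\<dots> = H x * (\<integral>\<^sup>+y. (\<Prod>j\<in>J. G x (y j)) \<partial>PiM J (\<lambda>_. M))"
    proof (rule nn_integral_cmult, rule borel_measurable_prod_ennreal)
      fix j assume "j \<in> J"
      then have "(\<lambda>y. y j) \<in> measurable (PiM J (\<lambda>_. M)) M"
        by (rule measurable_component_singleton)
      from measurable_compose[OF this Gx] show "(\<lambda>y. G x (y j)) \<in> borel_measurable (PiM J (\<lambda>_. M))" .
    qed
    also have "\<dots> = H x * (\<integral>\<^sup>+y. G x y \<partial>M) ^ card J"
      using fin Gx by (subst product_nn_integral_prod) auto
    finally show "(\<integral>\<^sup>+y. H (restrict (merge S J (x, y)) S) *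
          (\<Prod>j\<in>J. G (restrict (merge S J (x, y)) S) (merge S J (x, y) j)) \<partial>PiM J (\<lambda>_. M))
        = H x * (\<integral>\<^sup>+y. G x y \<partial>M) ^ card J" .
  qed
  finally show ?thesis .
qed

text \<open>The weight \<open>h\<close> is 1 for small cuts and the indicator of a set of positions
  for isolated vertices.\<close>

lemma nn_integral_cut_prob:
  assumes S: "S \<subseteq> {1..n}" and h: "h \<in> borel_measurable M"
  shows "(\<integral>\<^sup>+X. (\<Prod>i\<in>S. h (X i)) * ennreal (cut_prob \<kappa> n S X) \<partial>positions n)
       = (\<integral>\<^sup>+x. (\<Prod>i\<in>S. h (x i)) * (\<integral>\<^sup>+y. ennreal (\<Prod>i\<in>S. 1 - link_prob \<kappa> n (x i) y) \<partial>M) ^ (n - card S)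
            \<partial>PiM S (\<lambda>_. M))"
proof -
  let ?J = "{1..n} - S"
  have fin: "finite S" using S finite_subset by blast
  define H where "H x = (\<Prod>i\<in>S. h (x i))" for x :: "nat \<Rightarrow> 'a"
  define G where "G x y = ennreal (\<Prod>i\<in>S. 1 - link_prob \<kappa> n (x i) y)" for x :: "nat \<Rightarrow> 'a" and y
  have comp: "(\<lambda>x. x i) \<in> measurable (PiM S (\<lambda>_. M)) M" if "i \<in> S" for i
    using that by (rule measurable_component_singleton)
  have H: "H \<in> borel_measurable (PiM S (\<lambda>_. M))"
    unfolding H_def[abs_def] using measurable_compose[OF comp h] by (intro borel_measurable_prod_ennreal)
  have "(\<lambda>z. ennreal (\<Prod>i\<in>S. 1 - link_prob \<kappa> n (fst z i) (snd z))) \<in> borel_measurable (PiM S (\<lambda>_. M) \<Otimes>\<^sub>M M)"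
    using measurable_compose[OF measurable_fst comp]
    by (intro measurable_compose[OF _ measurable_ennreal] borel_measurable_prod borel_measurable_diff
        borel_measurable_const link_prob_measurable) auto
  then have G: "(\<lambda>(x, y). G x y) \<in> borel_measurable (PiM S (\<lambda>_. M) \<Otimes>\<^sub>M M)"
    by (simp add: G_def case_prod_beta)
  have "ennreal (cut_prob \<kappa> n S X) = (\<Prod>j\<in>?J. G (restrict X S) (X j))" for X
    unfolding cut_prob_def G_def
    by (subst prod_ennreal) (auto intro!: prod_nonneg simp: link_bounds)
  moreover have "(\<Prod>i\<in>S. h (X i)) = H (restrict X S)" for X
    by (simp add: H_def)
  moreover have "S \<union> ?J = {1..n}" "card ?J = n - card S"
    using S fin by (auto simp: card_Diff_subset)
  ultimately show ?thesis
    using nn_integral_PiM_split[OF fin _ _ H G, of ?J] by (simp add: H_def G_def)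
qed

text \<open>Integrability is required separately: a non-integrable square has Bochner integral 0 and
  would satisfy the bound for every nonnegative \<open>C\<close>.\<close>

definition good_point :: "real \<Rightarrow> 'a \<Rightarrow> bool" where
  "good_point C x \<longleftrightarrow> x \<in> space M \<and> integrable M (\<lambda>y. (\<kappa> x y)\<^sup>2) \<and> (\<integral>y. (\<kappa> x y)\<^sup>2 \<partial>M) \<le> C"

text \<open>The real-valued form of \<open>lambda\<close>; the two agree at good points.\<close>

definition degree :: "'a \<Rightarrow> real" where
  "degree x = (\<integral>y. \<kappa> x y \<partial>M)"

definition mean_link :: "nat \<Rightarrow> 'a \<Rightarrow> real" where
  "mean_link n x = (\<integral>y. link_prob \<kappa> n x y \<partial>M)"

section \<open>Moments of link probabilities with one endpoint fixed\<close>

lemma kernel_section_measurable: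
  assumes "x \<in> space M"
  shows "(\<lambda>y. \<kappa> x y) \<in> borel_measurable M"
  using measurable_Pair2[OF kernel_measurable assms] by simp

lemma link_section_measurable [measurable]:
  assumes "x \<in> space M"
  shows "(\<lambda>y. link_prob \<kappa> n x y) \<in> borel_measurable M"
  using assms by measurable

lemma link_integrable:
  assumes "x \<in> space M"
  shows "integrable M (\<lambda>y. link_prob \<kappa> n x y)"
  using link_section_measurable[OF assms] link_bounds
  by (intro integrable_const_bound[where B = 1]) (auto simp: abs_of_nonneg)

lemma link_sq_integrable:
  assumes "x \<in> space M"
  shows "integrable M (\<lambda>y. (link_prob \<kappa> n x y)\<^sup>2)"
  using link_section_measurable[OF assms] link_bounds
  by (intro integrable_const_bound[where B = 1]) (auto simp: abs_square_le_1 abs_of_nonneg)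

lemma good_point_integrable:
  assumes "good_point C x"
  shows "integrable M (\<lambda>y. \<kappa> x y)"
  using assms kernel_section_measurable square_integrable_imp_integrable
  unfolding good_point_def by blast

lemma mean_link_nonneg: "0 \<le> mean_link n x"
  unfolding mean_link_def by (intro integral_nonneg_AE) (simp add: link_bounds)

lemma mean_link_le:
  assumes "good_point C x"
  shows "mean_link n x \<le> ln (real n) / real n * degree x"
proof -
  have "mean_link n x \<le> (\<integral>y. \<kappa> x y * (ln (real n) / real n) \<partial>M)"
    unfolding mean_link_def using assms good_point_integrable[OF assms]
    by (intro integral_mono link_integrable) (auto simp: good_point_def link_prob_def)
  then show ?thesis by (simp add: degree_def mult.commute)
qed

lemma link_sq_integral_le:
  assumes "good_point C x"
  shows "(\<integral>y. (link_prob \<kappa> n x y)\<^sup>2 \<partial>M) \<le> C * (ln (real n) / real n)\<^sup>2"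
proof -
  have x: "x \<in> space M" using assms by (simp add: good_point_def)
  have "(\<integral>y. (link_prob \<kappa> n x y)\<^sup>2 \<partial>M) \<le> (\<integral>y. (\<kappa> x y)\<^sup>2 * (ln (real n) / real n)\<^sup>2 \<partial>M)"
  proof (intro integral_mono link_sq_integrable[OF x])
    show "integrable M (\<lambda>y. (\<kappa> x y)\<^sup>2 * (ln (real n) / real n)\<^sup>2)"
      using assms by (auto simp: good_point_def)
    fix y
    have "link_prob \<kappa> n x y \<le> \<kappa> x y * (ln (real n) / real n)"
      by (simp add: link_prob_def)
    then have "(link_prob \<kappa> n x y)\<^sup>2 \<le> (\<kappa> x y * (ln (real n) / real n))\<^sup>2"
      using link_bounds by (intro power_mono) auto
    then show "(link_prob \<kappa> n x y)\<^sup>2 \<le> (\<kappa> x y)\<^sup>2 * (ln (real n) / real n)\<^sup>2"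
      by (simp only: power_mult_distrib)
  qed
  also have "\<dots> = (\<integral>y. (\<kappa> x y)\<^sup>2 \<partial>M) * (ln (real n) / real n)\<^sup>2"
    by (rule integral_mult_left_zero)
  also have "\<dots> \<le> C * (ln (real n) / real n)\<^sup>2"
    using assms by (intro mult_right_mono) (auto simp: good_point_def)
  finally show ?thesis .
qed

text \<open>From \<open>t - t\<^sup>2 \<le> min 1 t\<close>: truncation of the link probability
  costs at most its second moment, which is of order \<open>p\<^sup>2\<close>.\<close>

lemma mean_link_ge:
  assumes "good_point C x"
  shows "ln (real n) / real n * degree x - C * (ln (real n) / real n)\<^sup>2 \<le> mean_link n x"
proof -
  let ?p = "ln (real n) / real n"
  have x: "x \<in> space M" using assms by (simp add: good_point_def)
  have "(\<integral>y. \<kappa> x y * ?p - (\<kappa> x y)\<^sup>2 * ?p\<^sup>2 \<partial>M) \<le> mean_link n x"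
    unfolding mean_link_def
  proof (intro integral_mono link_integrable[OF x])
    show "integrable M (\<lambda>y. \<kappa> x y * ?p - (\<kappa> x y)\<^sup>2 * ?p\<^sup>2)"
      using assms good_point_integrable[OF assms] by (auto simp: good_point_def)
    fix y
    have "t - t\<^sup>2 \<le> min 1 t" for t :: real
    proof -
      have "0 \<le> (t - 1 / 2)\<^sup>2" by simp
      then have "t - t\<^sup>2 \<le> 1" by (simp add: power2_eq_square algebra_simps)
      then show ?thesis by simp
    qed
    from this[of "\<kappa> x y * ?p"] show "\<kappa> x y * ?p - (\<kappa> x y)\<^sup>2 * ?p\<^sup>2 \<le> link_prob \<kappa> n x y"
      by (simp only: link_prob_def power_mult_distrib)
  qed
  moreover have "(\<integral>y. \<kappa> x y * ?p - (\<kappa> x y)\<^sup>2 * ?p\<^sup>2 \<partial>M) = degree x * ?p - (\<integral>y. (\<kappa> x y)\<^sup>2 \<partial>M) * ?p\<^sup>2"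
    using assms good_point_integrable[OF assms]
    by (subst Bochner_Integration.integral_diff) (simp_all add: good_point_def degree_def)
  moreover have "(\<integral>y. (\<kappa> x y)\<^sup>2 \<partial>M) * ?p\<^sup>2 \<le> C * ?p\<^sup>2"
    using assms by (intro mult_right_mono) (auto simp: good_point_def)
  ultimately show ?thesis by (simp add: mult.commute)
qed

text \<open>This bounds the probability that one outside vertex misses all of \<open>T\<close>. In
  the bracket, \<open>C * p\<close> is the loss from truncation, and the last term is the quadratic
  remainder of the product.\<close>

lemma cut_section_integral_le:
  assumes fin: "finite T" and good: "\<And>i. i \<in> T \<Longrightarrow> good_point C (x i)"
    and deg: "\<And>i. i \<in> T \<Longrightarrow> c \<le> degree (x i)"
    and p: "p = ln (real n) / real n"
  shows "(\<integral>y. (\<Prod>i\<in>T. 1 - link_prob \<kappa> n (x i) y) \<partial>M)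
     \<le> 1 - real (card T) * p * (c - C * p - C * (real (card T) * p) / 2)"
proof -
  let ?k = "real (card T)"
  have sp: "x i \<in> space M" if "i \<in> T" for i using good[OF that] by (simp add: good_point_def)
  have p0: "0 \<le> p" using ln_div_nonneg p by simp
  have "(\<integral>y. (\<Prod>i\<in>T. 1 - link_prob \<kappa> n (x i) y) \<partial>M)
    \<le> (\<integral>y. 1 - (\<Sum>i\<in>T. link_prob \<kappa> n (x i) y) + ?k / 2 * (\<Sum>i\<in>T. (link_prob \<kappa> n (x i) y)\<^sup>2) \<partial>M)"
  proof (rule integral_mono)
    show "integrable M (\<lambda>y. \<Prod>i\<in>T. 1 - link_prob \<kappa> n (x i) y)"
    proof (rule integrable_const_bound[where B = 1])
      show "(\<lambda>y. \<Prod>i\<in>T. 1 - link_prob \<kappa> n (x i) y) \<in> borel_measurable M"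
        using sp by (intro borel_measurable_prod borel_measurable_diff borel_measurable_const link_section_measurable)
      have "\<bar>\<Prod>i\<in>T. 1 - link_prob \<kappa> n (x i) y\<bar> \<le> 1" for y
        unfolding abs_prod
      proof (intro prod_le_1 conjI)
        show "\<bar>1 - link_prob \<kappa> n (x i) y\<bar> \<le> 1" for i
          using link_bounds[of n "x i" y] by (simp add: abs_le_iff)
      qed simp
      then show "AE y in M. norm (\<Prod>i\<in>T. 1 - link_prob \<kappa> n (x i) y) \<le> 1" by simp
    qed
    show "integrable M (\<lambda>y. 1 - (\<Sum>i\<in>T. link_prob \<kappa> n (x i) y) + ?k / 2 * (\<Sum>i\<in>T. (link_prob \<kappa> n (x i) y)\<^sup>2))"
      using sp link_integrable link_sq_integrable
      by (intro Bochner_Integration.integrable_add Bochner_Integration.integrable_diff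
          Bochner_Integration.integrable_sum Bochner_Integration.integrable_mult_right) auto
    show "(\<Prod>i\<in>T. 1 - link_prob \<kappa> n (x i) y)
      \<le> 1 - (\<Sum>i\<in>T. link_prob \<kappa> n (x i) y) + ?k / 2 * (\<Sum>i\<in>T. (link_prob \<kappa> n (x i) y)\<^sup>2)" for y
      by (intro prod_one_minus_le_quadratic) (auto simp: link_bounds)
  qed
  also have "\<dots> = 1 - (\<Sum>i\<in>T. mean_link n (x i)) + ?k / 2 * (\<Sum>i\<in>T. \<integral>y. (link_prob \<kappa> n (x i) y)\<^sup>2 \<partial>M)"
    using sp link_integrable link_sq_integrable by (simp add: mean_link_def prob_space)
  also have "\<dots> \<le> 1 - (\<Sum>i\<in>T. p * c - C * p\<^sup>2) + ?k / 2 * (\<Sum>i\<in>T. C * p\<^sup>2)"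
  proof -
    have "p * c - C * p\<^sup>2 \<le> mean_link n (x i)" if "i \<in> T" for i
      using mean_link_ge[OF good[OF that], of n] mult_left_mono[OF deg[OF that] p0] by (simp add: p)
    then have "(\<Sum>i\<in>T. p * c - C * p\<^sup>2) \<le> (\<Sum>i\<in>T. mean_link n (x i))"
      by (rule sum_mono)
    moreover have "(\<Sum>i\<in>T. \<integral>y. (link_prob \<kappa> n (x i) y)\<^sup>2 \<partial>M) \<le> (\<Sum>i\<in>T. C * p\<^sup>2)"
      using link_sq_integral_le[OF good, of _ n] by (intro sum_mono) (simp add: p)
    then have "?k / 2 * (\<Sum>i\<in>T. \<integral>y. (link_prob \<kappa> n (x i) y)\<^sup>2 \<partial>M) \<le> ?k / 2 * (\<Sum>i\<in>T. C * p\<^sup>2)"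
      by (rule mult_left_mono) simp
    ultimately show ?thesis by linarith
  qed
  also have "\<dots> = 1 - ?k * p * (c - C * p - C * (?k * p) / 2)"
    by (simp add: power2_eq_square algebra_simps)
  finally show ?thesis .
qed

text \<open>Asymptotic independence of two isolation events, as seen by one further vertex: the
  mixed term \<open>2 * a * b\<close> is at most \<open>a\<^sup>2 + b\<^sup>2\<close>. The error
  survives \<open>n\<close> such vertices because \<open>n * p\<^sup>2\<close> tends to 0.\<close>

lemma pair_section_integral_le:
  assumes "good_point C x" "good_point C y"
  shows "(\<integral>z. (1 - link_prob \<kappa> n x z) * (1 - link_prob \<kappa> n y z) \<partial>M)
     \<le> (1 - mean_link n x) * (1 - mean_link n y) + C * (ln (real n) / real n)\<^sup>2"
proof -
  have sp: "x \<in> space M" "y \<in> space M" using assms by (auto simp: good_point_def)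
  note int = link_integrable[OF sp(1), of n] link_integrable[OF sp(2), of n]
    link_sq_integrable[OF sp(1), of n] link_sq_integrable[OF sp(2), of n]
  have "(\<integral>z. (1 - link_prob \<kappa> n x z) * (1 - link_prob \<kappa> n y z) \<partial>M)
     \<le> (\<integral>z. 1 - link_prob \<kappa> n x z - link_prob \<kappa> n y z + ((link_prob \<kappa> n x z)\<^sup>2 + (link_prob \<kappa> n y z)\<^sup>2) / 2 \<partial>M)"
  proof (rule integral_mono)
    show "integrable M (\<lambda>z. (1 - link_prob \<kappa> n x z) * (1 - link_prob \<kappa> n y z))"
    proof (rule integrable_const_bound[where B = 1])
      show "(\<lambda>z. (1 - link_prob \<kappa> n x z) * (1 - link_prob \<kappa> n y z)) \<in> borel_measurable M"
        using sp by measurable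
      have "\<bar>(1 - link_prob \<kappa> n x z) * (1 - link_prob \<kappa> n y z)\<bar> \<le> 1" for z
        unfolding abs_mult using link_bounds[of n x z] link_bounds[of n y z] by (intro mult_le_one) auto
      then show "AE z in M. norm ((1 - link_prob \<kappa> n x z) * (1 - link_prob \<kappa> n y z)) \<le> 1" by simp
    qed
    show "(1 - link_prob \<kappa> n x z) * (1 - link_prob \<kappa> n y z)
      \<le> 1 - link_prob \<kappa> n x z - link_prob \<kappa> n y z + ((link_prob \<kappa> n x z)\<^sup>2 + (link_prob \<kappa> n y z)\<^sup>2) / 2" for z
      using sum_squares_bound[of "link_prob \<kappa> n x z" "link_prob \<kappa> n y z"] by (simp add: algebra_simps)
  qed (use int in auto)
  also have "\<dots> = 1 - mean_link n x - mean_link n y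
      + ((\<integral>z. (link_prob \<kappa> n x z)\<^sup>2 \<partial>M) + (\<integral>z. (link_prob \<kappa> n y z)\<^sup>2 \<partial>M)) / 2"
    using int by (simp add: mean_link_def prob_space)
  also have "\<dots> \<le> 1 - mean_link n x - mean_link n y + C * (ln (real n) / real n)\<^sup>2"
    using add_mono[OF link_sq_integral_le[OF assms(1), of n] link_sq_integral_le[OF assms(2), of n]]
    by (simp add: field_simps)
  also have "\<dots> \<le> (1 - mean_link n x) * (1 - mean_link n y) + C * (ln (real n) / real n)\<^sup>2"
    using mult_nonneg_nonneg[OF mean_link_nonneg[of n x] mean_link_nonneg[of n y]] by (simp add: algebra_simps)
  finally show ?thesis .
qed

text \<open>The nonnegative integral serves the union bound; the Bochner integral serves the
  second-moment bound, whose integrand has terms of both signs.\<close>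

lemma random_graph_prob:
  "(\<lambda>X. measure_pmf.prob (graph_pmf \<kappa> n X) A) \<in> borel_measurable (positions n)"
  "ennreal (measure (random_graph M \<kappa> n) A) = (\<integral>\<^sup>+X. ennreal (measure_pmf.prob (graph_pmf \<kappa> n X) A) \<partial>positions n)"
  "measure (random_graph M \<kappa> n) A = (\<integral>X. measure_pmf.prob (graph_pmf \<kappa> n X) A \<partial>positions n)"
proof -
  interpret P: prob_space "positions n" by (rule prob_space_positions)
  have "(\<lambda>X. emeasure (measure_pmf (graph_pmf \<kappa> n X)) A) \<in> borel_measurable (positions n)"
    using measurable_compose[OF measurable_graph_pmf[OF kernel_measurable] measurable_emeasure_subprob_algebra[of A]]
    by simp
  from measurable_compose[OF this borel_measurable_enn2real[OF measurable_ident]]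
  show m: "(\<lambda>X. measure_pmf.prob (graph_pmf \<kappa> n X) A) \<in> borel_measurable (positions n)"
    by (simp add: measure_def)
  have "integrable (positions n) (\<lambda>X. measure_pmf.prob (graph_pmf \<kappa> n X) A)"
    using m by (intro P.integrable_const_bound[where B = 1]) auto
  then have i: "(\<integral>\<^sup>+X. ennreal (measure_pmf.prob (graph_pmf \<kappa> n X) A) \<partial>positions n)
     = ennreal (\<integral>X. measure_pmf.prob (graph_pmf \<kappa> n X) A \<partial>positions n)"
    by (intro nn_integral_eq_integral) auto
  have "emeasure (random_graph M \<kappa> n) A = (\<integral>\<^sup>+X. ennreal (measure_pmf.prob (graph_pmf \<kappa> n X) A) \<partial>positions n)"
    by (simp add: emeasure_random_graph[OF prob_space_axioms kernel_measurable] measure_pmf.emeasure_eq_measure)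
  with i show e: "measure (random_graph M \<kappa> n) A = (\<integral>X. measure_pmf.prob (graph_pmf \<kappa> n X) A \<partial>positions n)"
    by (simp add: measure_def integral_nonneg_AE)
  with i show "ennreal (measure (random_graph M \<kappa> n) A) = (\<integral>\<^sup>+X. ennreal (measure_pmf.prob (graph_pmf \<kappa> n X) A) \<partial>positions n)"
    by simp
qed

lemma random_graph_connected_eq:
  "measure (random_graph M \<kappa> n) {G. graph_connected G} = 1 - measure (random_graph M \<kappa> n) {G. \<not> graph_connected G}"
proof -
  interpret P: prob_space "positions n" by (rule prob_space_positions)
  have "integrable (positions n) (\<lambda>X. measure_pmf.prob (graph_pmf \<kappa> n X) A)" for A
    using random_graph_prob(1) by (intro P.integrable_const_bound[where B = 1]) auto
  moreover have "measure_pmf.prob (graph_pmf \<kappa> n X) {G. graph_connected G}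
      = 1 - measure_pmf.prob (graph_pmf \<kappa> n X) {G. \<not> graph_connected G}" for X
    using measure_pmf.prob_compl[of "{G. \<not> graph_connected G}" "graph_pmf \<kappa> n X"]
    by (simp add: Compl_eq_Diff_UNIV[symmetric] Collect_neg_eq[symmetric])
  ultimately show ?thesis
    by (simp add: random_graph_prob(3) P.prob_space)
qed

text \<open>A negative \<open>t\<close> gives the lower tail, a positive one the upper tail.\<close>

lemma count_tail:
  assumes A: "A \<in> sets M"
  shows "measure (positions n) {X \<in> space (positions n). t * b * real n \<le> t * real (card {i\<in>{1..n}. X i \<in> A})}
      \<le> exp (real n * (prob A * (exp t - 1) - t * b))"
proof -
  interpret P: prob_space "positions n" by (rule prob_space_positions)
  interpret product_sigma_finite "\<lambda>_::nat. M" by (rule product_sigma_finite_const)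
  let ?g = "\<lambda>x. exp (t * indicator A x) :: real"
  \<comment> \<open>Exponential Markov inequality: \<open>Y\<close> is the exponential of
    \<open>t\<close> times the count, in product form so that its mean factorizes.\<close>
  define Y where "Y X = (\<Prod>i\<in>{1..n}. ?g (X i))" for X :: "nat \<Rightarrow> 'a"
  have gm: "?g \<in> borel_measurable M" using A by measurable
  have gint: "integrable M ?g"
    using gm by (intro integrable_const_bound[where B = "exp \<bar>t\<bar>"]) (auto simp: indicator_def)
  have "(\<integral>x. ?g x \<partial>M) = (\<integral>x. 1 + (exp t - 1) * indicator A x \<partial>M)"
    by (intro Bochner_Integration.integral_cong) (auto simp: indicator_def)
  also have "\<dots> = 1 + prob A * (exp t - 1)"
  proof -
    have "integrable M (indicat_real A)"
      using A by (intro integrable_real_indicator) (auto simp: less_top[symmetric])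
    then show ?thesis
      using A by (subst Bochner_Integration.integral_add) (auto simp: prob_space)
  qed
  finally have gi: "(\<integral>x. ?g x \<partial>M) = 1 + prob A * (exp t - 1)" .
  have EY: "(\<integral>X. Y X \<partial>positions n) = (1 + prob A * (exp t - 1)) ^ n"
    unfolding Y_def using gint gi by (subst product_integral_prod) auto
  have Yint: "integrable (positions n) Y"
    unfolding Y_def[abs_def] using gint by (intro product_integrable_prod) auto
  have Yeq: "Y X = exp (t * real (card {i\<in>{1..n}. X i \<in> A}))" for X
  proof -
    have "Y X = exp (\<Sum>i\<in>{1..n}. t * indicator A (X i))"
      unfolding Y_def by (rule exp_sum[symmetric]) simp
    also have "(\<Sum>i\<in>{1..n}. t * indicator A (X i)) = t * (\<Sum>i\<in>{1..n}. indicator {i\<in>{1..n}. X i \<in> A} i)"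
      by (simp add: sum_distrib_left indicator_def)
    also have "(\<Sum>i\<in>{1..n}. indicator {i\<in>{1..n}. X i \<in> A} i) = real (card {i\<in>{1..n}. X i \<in> A})"
      unfolding indicator_def of_bool_def
      by (subst sum.If_cases) (auto simp: Int_def intro!: arg_cong[where f = card])
    finally show ?thesis .
  qed
  have "measure (positions n) {X \<in> space (positions n). t * b * real n \<le> t * real (card {i\<in>{1..n}. X i \<in> A})}
      = measure (positions n) {X \<in> space (positions n). exp (t * b * real n) \<le> Y X}"
    by (simp add: Yeq)
  also have "\<dots> \<le> (\<integral>X. Y X \<partial>positions n) / exp (t * b * real n)"
  proof (rule integral_Markov_inequality_measure[OF Yint, where A = "space (positions n)"])
    show "AE X in positions n. 0 \<le> Y X" unfolding Y_def by (intro AE_I2 prod_nonneg) auto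
  qed auto
  also have "\<dots> \<le> exp (prob A * (exp t - 1)) ^ n / exp (t * b * real n)"
  proof -
    have "0 \<le> (\<integral>x. ?g x \<partial>M)" by (intro integral_nonneg_AE) auto
    then have "(1 + prob A * (exp t - 1)) ^ n \<le> exp (prob A * (exp t - 1)) ^ n"
      unfolding gi by (intro power_mono exp_ge_add_one_self)
    then show ?thesis unfolding EY by (simp add: divide_right_mono)
  qed
  also have "\<dots> = exp (real n * (prob A * (exp t - 1) - t * b))"
    by (simp add: exp_of_nat_mult[symmetric] exp_diff[symmetric] algebra_simps)
  finally show ?thesis .
qed

end

section \<open>Isolated vertices\<close>

context kernel_space
begin

lemma mean_link_measurable: "mean_link n \<in> borel_measurable M"
  unfolding mean_link_def[abs_def]
  by (intro borel_measurable_lebesgue_integral) (simp add: case_prod_beta, measurable)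

lemma nn_integral_one_minus_link:
  assumes "x \<in> space M"
  shows "(\<integral>\<^sup>+y. ennreal (1 - link_prob \<kappa> n x y) \<partial>M) = ennreal (1 - mean_link n x)"
proof -
  have "(\<integral>\<^sup>+y. ennreal (1 - link_prob \<kappa> n x y) \<partial>M) = ennreal (\<integral>y. 1 - link_prob \<kappa> n x y \<partial>M)"
    using link_integrable[OF assms] link_bounds by (intro nn_integral_eq_integral) auto
  then show ?thesis using link_integrable[OF assms] by (simp add: mean_link_def prob_space)
qed

lemma mean_link_le_1:
  assumes "x \<in> space M"
  shows "mean_link n x \<le> 1"
proof -
  have "mean_link n x \<le> (\<integral>y. 1 \<partial>M)"
    unfolding mean_link_def using link_integrable[OF assms] link_bounds by (intro integral_mono) auto
  then show ?thesis by (simp add: prob_space)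
qed

text \<open>For a vertex at \<open>x\<close> in \<open>B\<close>, the conditional probability that
  it has no neighbour; the exponent counts the other vertices.\<close>

definition isolation :: "'a set \<Rightarrow> nat \<Rightarrow> 'a \<Rightarrow> real" where
  "isolation B n x = indicator B x * (1 - mean_link n x) ^ (n - 1)"

lemma isolation_nonneg: "x \<in> space M \<Longrightarrow> 0 \<le> isolation B n x"
  by (simp add: isolation_def mean_link_le_1)

lemma isolation_measurable: "B \<in> sets M \<Longrightarrow> isolation B n \<in> borel_measurable M"
  unfolding isolation_def[abs_def]
  by (intro borel_measurable_times borel_measurable_power borel_measurable_diff
      mean_link_measurable borel_measurable_indicator) auto

lemma isolation_integrable: "B \<in> sets M \<Longrightarrow> integrable M (isolation B n)"
  using isolation_measurable mean_link_le_1 mean_link_nonneg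
  by (intro integrable_const_bound[where B = 1])
    (auto simp: isolation_def indicator_def abs_mult power_abs abs_of_nonneg intro!: power_le_one)

lemma nn_integral_isolation:
  "B \<in> sets M \<Longrightarrow> (\<integral>\<^sup>+x. ennreal (isolation B n x) \<partial>M) = ennreal (\<integral>x. isolation B n x \<partial>M)"
  using isolation_integrable isolation_nonneg by (intro nn_integral_eq_integral) auto

lemma expected_isolated:
  assumes B: "B \<in> sets M" and i: "i \<in> {1..n}"
  shows "(\<integral>X. indicator B (X i) * cut_prob \<kappa> n {i} X \<partial>positions n) = (\<integral>x. isolation B n x \<partial>M)"
proof -
  interpret product_sigma_finite "\<lambda>_::nat. M" by (rule product_sigma_finite_const)
  have comp: "(\<lambda>X. X i) \<in> measurable (positions n) M"
    using i by (rule measurable_component_singleton)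
  have "(\<lambda>X. indicator B (X i) * cut_prob \<kappa> n {i} X) \<in> borel_measurable (positions n)"
    using i measurable_compose[OF comp borel_measurable_indicator[OF B]]
    by (intro borel_measurable_times cut_prob_measurable) auto
  then have "(\<integral>X. indicator B (X i) * cut_prob \<kappa> n {i} X \<partial>positions n)
     = enn2real (\<integral>\<^sup>+X. ennreal (indicator B (X i) * cut_prob \<kappa> n {i} X) \<partial>positions n)"
    by (intro integral_eq_nn_integral) (auto simp: cut_prob_nonneg)
  also have "(\<integral>\<^sup>+X. ennreal (indicator B (X i) * cut_prob \<kappa> n {i} X) \<partial>positions n)
     = (\<integral>\<^sup>+X. (\<Prod>l\<in>{i}. indicator B (X l)) * ennreal (cut_prob \<kappa> n {i} X) \<partial>positions n)"
    by (intro nn_integral_cong) (simp add: indicator_def)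
  also have "\<dots> = (\<integral>\<^sup>+x. (\<Prod>l\<in>{i}. indicator B (x l)) *
      (\<integral>\<^sup>+y. ennreal (\<Prod>l\<in>{i}. 1 - link_prob \<kappa> n (x l) y) \<partial>M) ^ (n - card {i}) \<partial>PiM {i} (\<lambda>_. M))"
    using i B by (intro nn_integral_cut_prob) auto
  also have "\<dots> = (\<integral>\<^sup>+x. ennreal (isolation B n (x i)) \<partial>PiM {i} (\<lambda>_. M))"
  proof (intro nn_integral_cong)
    fix x assume "x \<in> space (PiM {i} (\<lambda>_. M))"
    then have x: "x i \<in> space M" by (auto simp: space_PiM)
    then show "(\<Prod>l\<in>{i}. indicator B (x l)) *
      (\<integral>\<^sup>+y. ennreal (\<Prod>l\<in>{i}. 1 - link_prob \<kappa> n (x l) y) \<partial>M) ^ (n - card {i}) = ennreal (isolation B n (x i))"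
      by (simp add: nn_integral_one_minus_link isolation_def ennreal_power mean_link_le_1 indicator_def One_nat_def)
  qed
  also have "\<dots> = (\<integral>\<^sup>+x. ennreal (isolation B n x) \<partial>M)"
    using isolation_measurable[OF B, of n] by (intro product_nn_integral_singleton) measurable
  finally show ?thesis
    using isolation_nonneg by (simp add: nn_integral_isolation[OF B] integral_nonneg_AE)
qed

text \<open>The prefactor of the squared mean tends to 1. Its numerator collects the correlation
  error of the outside vertices. Its denominator pays for the exponent: only \<open>n - 2\<close>
  vertices lie outside the pair, while each \<open>isolation\<close> factor has exponent
  \<open>n - 1\<close>.\<close>

lemma expected_isolated_pair:
  assumes B: "B \<in> sets M" and ij: "i \<in> {1..n}" "j \<in> {1..n}" "i \<noteq> j"
    and good: "AE x in M. good_point C x" and C: "0 \<le> C"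
    and deg: "\<And>x. x \<in> B \<Longrightarrow> degree x \<le> c"
    and p: "p = ln (real n) / real n" and cp: "c * p \<le> 1 / 2"
  shows "(\<integral>X. indicator B (X i) * indicator B (X j) * cut_prob \<kappa> n {i, j} X \<partial>positions n)
     \<le> (1 + 4 * C * p\<^sup>2) ^ n / (1 - c * p)\<^sup>2 * (\<integral>x. isolation B n x \<partial>M)\<^sup>2"
proof -
  interpret product_sigma_finite "\<lambda>_::nat. M" by (rule product_sigma_finite_const)
  let ?R = "(1 + 4 * C * p\<^sup>2) ^ n / (1 - c * p)\<^sup>2"
  let ?I = "\<integral>x. isolation B n x \<partial>M"
  have p0: "0 \<le> p" using ln_div_nonneg p by simp
  have R0: "0 \<le> ?R" using C by simp
  have I0: "0 \<le> ?I" using isolation_nonneg by (intro integral_nonneg_AE) auto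
  have n2: "n \<ge> 2" using ij by auto
  have comp: "(\<lambda>X. X l) \<in> measurable (positions n) M" if "l \<in> {i, j}" for l
    using ij that by (intro measurable_component_singleton) auto
  have "(\<lambda>X. indicator B (X i) * indicator B (X j) * cut_prob \<kappa> n {i, j} X) \<in> borel_measurable (positions n)"
    using ij measurable_compose[OF comp borel_measurable_indicator[OF B]]
    by (intro borel_measurable_times cut_prob_measurable) auto
  then have eq: "(\<integral>X. indicator B (X i) * indicator B (X j) * cut_prob \<kappa> n {i, j} X \<partial>positions n)
     = enn2real (\<integral>\<^sup>+X. ennreal (indicator B (X i) * indicator B (X j) * cut_prob \<kappa> n {i, j} X) \<partial>positions n)"
    by (intro integral_eq_nn_integral) (auto simp: cut_prob_nonneg)
  have bound: "(\<integral>\<^sup>+X. ennreal (indicator B (X i) * indicator B (X j) * cut_prob \<kappa> n {i, j} X) \<partial>positions n)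
     \<le> ennreal (?R * ?I\<^sup>2)"
  proof -
    have "(\<integral>\<^sup>+X. ennreal (indicator B (X i) * indicator B (X j) * cut_prob \<kappa> n {i, j} X) \<partial>positions n)
       = (\<integral>\<^sup>+X. (\<Prod>l\<in>{i, j}. indicator B (X l)) * ennreal (cut_prob \<kappa> n {i, j} X) \<partial>positions n)"
      using ij by (intro nn_integral_cong) (simp add: indicator_def)
    also have "\<dots> = (\<integral>\<^sup>+x. (\<Prod>l\<in>{i, j}. indicator B (x l)) *
        (\<integral>\<^sup>+y. ennreal (\<Prod>l\<in>{i, j}. 1 - link_prob \<kappa> n (x l) y) \<partial>M) ^ (n - card {i, j}) \<partial>PiM {i, j} (\<lambda>_. M))"
      using ij B by (intro nn_integral_cut_prob) auto
    also have "\<dots> \<le> (\<integral>\<^sup>+x. ennreal ?R * (\<Prod>l\<in>{i, j}. ennreal (isolation B n (x l))) \<partial>PiM {i, j} (\<lambda>_. M))"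
    proof (rule nn_integral_mono_AE)
      have "AE x in PiM {i, j} (\<lambda>_. M). good_point C (x i)" "AE x in PiM {i, j} (\<lambda>_. M). good_point C (x j)"
        using good by (auto intro!: AE_PiM_component prob_space_axioms)
      then show "AE x in PiM {i, j} (\<lambda>_. M). (\<Prod>l\<in>{i, j}. indicator B (x l)) *
        (\<integral>\<^sup>+y. ennreal (\<Prod>l\<in>{i, j}. 1 - link_prob \<kappa> n (x l) y) \<partial>M) ^ (n - card {i, j})
        \<le> ennreal ?R * (\<Prod>l\<in>{i, j}. ennreal (isolation B n (x l)))"
      proof eventually_elim
        case (elim x)
        show ?case
        proof (cases "x i \<in> B \<and> x j \<in> B")
          case False
          then have "(\<Prod>l\<in>{i, j}. indicator B (x l)) = (0 :: ennreal)"
            using ij(3) by (auto simp: indicator_def)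
          then show ?thesis by (simp only: mult_zero_left zero_le)
        next
          case True
          have sp: "x i \<in> space M" "x j \<in> space M" using elim by (auto simp: good_point_def)
          have a: "mean_link n (x l) \<le> c * p" if "l = i \<or> l = j" for l
            using that elim True mean_link_le[of C "x l" n] mult_right_mono[OF deg[of "x l"] p0]
            by (auto simp: p mult.commute)
          define \<alpha> where "\<alpha> = (1 - mean_link n (x i)) * (1 - mean_link n (x j))"
          have al: "(1 - c * p)\<^sup>2 \<le> \<alpha>"
            unfolding \<alpha>_def power2_eq_square using a[of i] a[of j] cp by (intro mult_mono) auto
          have "(1 / 2)\<^sup>2 \<le> (1 - c * p)\<^sup>2" using cp by (intro power_mono) auto
          then have quarter: "1 / 4 \<le> (1 - c * p)\<^sup>2" by (simp add: power2_eq_square)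
          \<comment> \<open>Since \<alpha> is at least 1/4, the additive error
            \<open>C * p\<^sup>2\<close> becomes the relative error
            \<open>4 * C * p\<^sup>2\<close>, which can be raised to a power.\<close>
          then have al4: "1 \<le> 4 * \<alpha>" using al by linarith
          let ?s = "\<integral>y. (1 - link_prob \<kappa> n (x i) y) * (1 - link_prob \<kappa> n (x j) y) \<partial>M"
          have s0: "0 \<le> ?s" by (intro integral_nonneg_AE) (simp add: link_bounds)
          have "?s \<le> \<alpha> + C * p\<^sup>2"
            using pair_section_integral_le[OF elim(1,2), of n] by (simp add: \<alpha>_def p)
          also have "\<dots> \<le> \<alpha> + 4 * \<alpha> * (C * p\<^sup>2)"
            using mult_right_mono[OF al4, of "C * p\<^sup>2"] C by simp
          also have "\<dots> = \<alpha> * (1 + 4 * C * p\<^sup>2)" by (simp add: algebra_simps)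
          finally have "?s ^ (n - 2) \<le> (\<alpha> * (1 + 4 * C * p\<^sup>2)) ^ (n - 2)"
            using s0 by (rule power_mono)
          also have "\<dots> = \<alpha> ^ (n - 2) * (1 + 4 * C * p\<^sup>2) ^ (n - 2)" by (rule power_mult_distrib)
          also have "\<dots> \<le> \<alpha> ^ (n - 2) * (1 + 4 * C * p\<^sup>2) ^ n"
            using al4 C by (intro mult_left_mono power_increasing) auto
          \<comment> \<open>One more factor \<alpha> is supplied, at the cost of dividing by its
            lower bound.\<close>
          also have "\<alpha> ^ (n - 2) \<le> \<alpha> ^ (n - 1) / (1 - c * p)\<^sup>2"
          proof -
            have "n - 1 = Suc (n - 2)" using n2 by simp
            then have "\<alpha> ^ (n - 2) * (1 - c * p)\<^sup>2 \<le> \<alpha> ^ (n - 1)"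
              using al al4 mult_left_mono[of "(1 - c * p)\<^sup>2" \<alpha> "\<alpha> ^ (n - 2)"] by (simp add: mult.commute)
            then show ?thesis using quarter by (subst pos_le_divide_eq) auto
          qed
          finally have main: "?s ^ (n - 2) \<le> ?R * \<alpha> ^ (n - 1)"
            using C by (simp add: mult_right_mono mult.commute)
          have "(\<integral>\<^sup>+y. ennreal (\<Prod>l\<in>{i, j}. 1 - link_prob \<kappa> n (x l) y) \<partial>M) = ennreal ?s"
          proof -
            have "integrable M (\<lambda>y. (1 - link_prob \<kappa> n (x i) y) * (1 - link_prob \<kappa> n (x j) y))"
            proof (rule integrable_const_bound[where B = 1])
              show "(\<lambda>y. (1 - link_prob \<kappa> n (x i) y) * (1 - link_prob \<kappa> n (x j) y)) \<in> borel_measurable M"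
                using sp by measurable
              show "AE y in M. norm ((1 - link_prob \<kappa> n (x i) y) * (1 - link_prob \<kappa> n (x j) y)) \<le> 1"
                using link_bounds by (intro AE_I2) (auto simp: abs_mult intro!: mult_le_one)
            qed
            then show ?thesis
              using ij(3) by (simp add: nn_integral_eq_integral link_bounds)
          qed
          moreover have "card {i, j} = 2" using ij(3) by simp
          ultimately have "(\<Prod>l\<in>{i, j}. indicator B (x l)) *
            (\<integral>\<^sup>+y. ennreal (\<Prod>l\<in>{i, j}. 1 - link_prob \<kappa> n (x l) y) \<partial>M) ^ (n - card {i, j}) = ennreal (?s ^ (n - 2))"
            using True ij(3) s0 by (simp add: ennreal_power numeral_2_eq_2)
          also have "\<dots> \<le> ennreal (?R * \<alpha> ^ (n - 1))" using main by (rule ennreal_leI)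
          also have "\<dots> = ennreal ?R * (\<Prod>l\<in>{i, j}. ennreal (isolation B n (x l)))"
          proof -
            have "(\<Prod>l\<in>{i, j}. ennreal (isolation B n (x l))) = ennreal (isolation B n (x i) * isolation B n (x j))"
              using ij(3) sp by (simp add: ennreal_mult' isolation_nonneg)
            also have "isolation B n (x i) * isolation B n (x j) = \<alpha> ^ (n - 1)"
              using True by (simp add: isolation_def \<alpha>_def power_mult_distrib)
            finally show ?thesis by (simp only: ennreal_mult'[OF R0])
          qed
          finally show ?thesis .
        qed
      qed
    qed
    also have "\<dots> = ennreal ?R * (\<integral>\<^sup>+x. (\<Prod>l\<in>{i, j}. ennreal (isolation B n (x l))) \<partial>PiM {i, j} (\<lambda>_. M))"
    proof (rule nn_integral_cmult, rule borel_measurable_prod_ennreal)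
      fix l assume "l \<in> {i, j}"
      then have "(\<lambda>y. y l) \<in> measurable (PiM {i, j} (\<lambda>_. M)) M"
        by (rule measurable_component_singleton)
      from measurable_compose[OF this isolation_measurable[OF B]]
      show "(\<lambda>y. ennreal (isolation B n (y l))) \<in> borel_measurable (PiM {i, j} (\<lambda>_. M))" by measurable
    qed
    also have "\<dots> = ennreal ?R * (\<Prod>l\<in>{i, j}. \<integral>\<^sup>+x. ennreal (isolation B n x) \<partial>M)"
      using isolation_measurable[OF B] by (subst product_nn_integral_prod) auto
    also have "\<dots> = ennreal (?R * ?I\<^sup>2)"
    proof -
      have "(\<Prod>l\<in>{i, j}. \<integral>\<^sup>+x. ennreal (isolation B n x) \<partial>M) = ennreal (?I\<^sup>2)"
        using ij(3) I0 by (simp add: nn_integral_isolation[OF B] ennreal_mult' power2_eq_square)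
      then show ?thesis by (simp only: ennreal_mult'[OF R0])
    qed
    finally show ?thesis .
  qed
  have "0 \<le> ?R * ?I\<^sup>2" using R0 by (rule mult_nonneg_nonneg) simp
  with enn2real_mono[OF bound ennreal_less_top] show ?thesis
    unfolding eq by (simp only: enn2real_ennreal)
qed

text \<open>The moment inequality centred at the mean number \<open>m\<close> of isolated vertices
  in \<open>B\<close> gives \<open>1 - 2 + 1 / m + R\<close>, with \<open>R\<close> the prefactor of
  the pair estimate. Thus \<open>R\<close> has to tend to 1 and \<open>m\<close> to
  infinity.\<close>

lemma connected_prob_le:
  assumes B: "B \<in> sets M" "0 < prob B"
    and good: "AE x in M. good_point C x" and C: "0 \<le> C"
    and deg: "\<And>x. x \<in> B \<Longrightarrow> degree x \<le> c"
    and p: "p = ln (real n) / real n" and cp: "c * p \<le> 1 / 2" and n: "2 \<le> n"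
  shows "measure (random_graph M \<kappa> n) {G. graph_connected G}
    \<le> (1 + 4 * C * p\<^sup>2) ^ n / (1 - c * p)\<^sup>2 - 1 + 1 / (real n * prob B * (1 - c * p) ^ (n - 1))"
proof -
  interpret P: prob_space "positions n" by (rule prob_space_positions)
  let ?R = "(1 + 4 * C * p\<^sup>2) ^ n / (1 - c * p)\<^sup>2"
  define I where "I = (\<integral>x. isolation B n x \<partial>M)"
  define m where "m = real n * I"
  have p0: "0 \<le> p" using ln_div_nonneg p by simp
  have R0: "0 \<le> ?R" using C by simp
  have I_ge: "prob B * (1 - c * p) ^ (n - 1) \<le> I"
  proof -
    have "prob B * (1 - c * p) ^ (n - 1) = (\<integral>x. indicator B x * (1 - c * p) ^ (n - 1) \<partial>M)"
      using B by simp
    also have "\<dots> \<le> I"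
      unfolding I_def
    proof (rule integral_mono_AE)
      show "integrable M (\<lambda>x. indicator B x * (1 - c * p) ^ (n - 1))"
        using B by (intro integrable_mult_left integrable_real_indicator) (auto simp: less_top[symmetric])
      show "AE x in M. indicator B x * (1 - c * p) ^ (n - 1) \<le> isolation B n x"
        using good
      proof eventually_elim
        case (elim x)
        have "mean_link n x \<le> c * p" if "x \<in> B"
          using mean_link_le[OF elim, of n] mult_right_mono[OF deg[OF that] p0] by (simp add: p mult.commute)
        then show ?case
          using cp by (auto simp: isolation_def indicator_def intro!: power_mono)
      qed
    qed (rule isolation_integrable[OF B(1)])
    finally show ?thesis .
  qed
  have low: "0 < prob B * (1 - c * p) ^ (n - 1)" using B cp by simp
  with I_ge have I0: "0 < I" by linarith
  with n have m0: "0 < m" by (simp add: m_def)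
  have comp: "(\<lambda>X. X i) \<in> measurable (positions n) M" if "i \<in> {1..n}" for i
    using that by (intro measurable_component_singleton) auto
  have ind: "(\<lambda>X. indicator B (X i) :: real) \<in> borel_measurable (positions n)" if "i \<in> {1..n}" for i
    using measurable_compose[OF comp[OF that] borel_measurable_indicator[OF B(1)]] .
  have int1: "integrable (positions n) (\<lambda>X. indicator B (X i) * cut_prob \<kappa> n {i} X)" if "i \<in> {1..n}" for i
    using that ind cut_prob_measurable[of "{i}" n] cut_prob_le_1 cut_prob_nonneg
    by (intro P.integrable_const_bound[where B = 1]) (auto simp: indicator_def abs_of_nonneg cut_prob_nonneg cut_prob_le_1)
  have int2: "integrable (positions n) (\<lambda>X. indicator B (X i) * indicator B (X j) * cut_prob \<kappa> n {i, j} X)"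
    if "i \<in> {1..n}" "j \<in> {1..n}" for i j
    using that ind cut_prob_measurable[of "{i, j}" n] cut_prob_le_1 cut_prob_nonneg
    by (intro P.integrable_const_bound[where B = 1]) (auto simp: indicator_def abs_of_nonneg cut_prob_nonneg cut_prob_le_1)
  let ?f1 = "\<lambda>X. \<Sum>i\<in>{1..n}. indicator B (X i) * cut_prob \<kappa> n {i} X"
  let ?f2 = "\<lambda>X. \<Sum>i\<in>{1..n}. \<Sum>j\<in>{1..n} - {i}. indicator B (X i) * indicator B (X j) * cut_prob \<kappa> n {i, j} X"
  have i1: "integrable (positions n) ?f1" using int1 by (intro Bochner_Integration.integrable_sum) auto
  have i2: "integrable (positions n) ?f2" using int2 by (intro Bochner_Integration.integrable_sum) auto
  have "(\<integral>X. ?f1 X \<partial>positions n) = (\<Sum>i\<in>{1..n}. \<integral>X. indicator B (X i) * cut_prob \<kappa> n {i} X \<partial>positions n)"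
    using int1 by (rule Bochner_Integration.integral_sum)
  also have "\<dots> = (\<Sum>i\<in>{1..n}. I)"
    unfolding I_def using B(1) by (intro sum.cong refl expected_isolated)
  finally have f1: "(\<integral>X. ?f1 X \<partial>positions n) = m"
    by (simp add: m_def)
  have "(\<integral>X. ?f2 X \<partial>positions n) = (\<Sum>i\<in>{1..n}. \<Sum>j\<in>{1..n} - {i}.
      \<integral>X. indicator B (X i) * indicator B (X j) * cut_prob \<kappa> n {i, j} X \<partial>positions n)"
    using int2 by (subst Bochner_Integration.integral_sum) (auto intro!: sum.cong Bochner_Integration.integral_sum)
  also have "\<dots> \<le> (\<Sum>i\<in>{1..n}. \<Sum>j\<in>{1..n} - {i}. ?R * I\<^sup>2)"
    unfolding I_def using B(1) good C deg p cp by (intro sum_mono expected_isolated_pair) auto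
  \<comment> \<open>Restoring the diagonal replaces \<open>n * (n - 1)\<close> by
    \<open>n\<^sup>2\<close>, so that the sum is exactly \<open>m\<^sup>2 * ?R\<close>.\<close>
  also have "\<dots> \<le> (\<Sum>i\<in>{1..n}. \<Sum>j\<in>{1..n}. ?R * I\<^sup>2)"
    by (intro sum_mono sum_mono2 mult_nonneg_nonneg R0 zero_le_power2) auto
  also have "\<dots> = m\<^sup>2 * ?R" by (simp add: m_def power2_eq_square)
  finally have f2: "(\<integral>X. ?f2 X \<partial>positions n) \<le> m\<^sup>2 * ?R" .
  have "measure (random_graph M \<kappa> n) {G. graph_connected G}
      = (\<integral>X. measure_pmf.prob (graph_pmf \<kappa> n X) {G. graph_connected G} \<partial>positions n)"
    by (rule random_graph_prob(3))
  also have "\<dots> \<le> (\<integral>X. 1 - 2 / m * ?f1 X + 1 / m\<^sup>2 * ?f1 X + 1 / m\<^sup>2 * ?f2 X \<partial>positions n)"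
  proof (rule integral_mono)
    show "integrable (positions n) (\<lambda>X. measure_pmf.prob (graph_pmf \<kappa> n X) {G. graph_connected G})"
      using random_graph_prob(1) by (intro P.integrable_const_bound[where B = 1]) auto
    show "integrable (positions n) (\<lambda>X. 1 - 2 / m * ?f1 X + 1 / m\<^sup>2 * ?f1 X + 1 / m\<^sup>2 * ?f2 X)"
      using i1 i2 by (intro Bochner_Integration.integrable_add Bochner_Integration.integrable_diff
          Bochner_Integration.integrable_mult_right) auto
    show "measure_pmf.prob (graph_pmf \<kappa> n X) {G. graph_connected G}
       \<le> 1 - 2 / m * ?f1 X + 1 / m\<^sup>2 * ?f1 X + 1 / m\<^sup>2 * ?f2 X" for X
      using kernel_nonneg kernel_sym n m0
      by (intro prob_connected_second_moment[where w = "\<lambda>i. indicator B (X i)"]) (auto simp: indicator_def)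
  qed
  also have "\<dots> = 1 - 2 / m * (\<integral>X. ?f1 X \<partial>positions n) + 1 / m\<^sup>2 * (\<integral>X. ?f1 X \<partial>positions n)
      + 1 / m\<^sup>2 * (\<integral>X. ?f2 X \<partial>positions n)"
    using i1 i2 by (simp only: Bochner_Integration.integral_add Bochner_Integration.integral_diff
          Bochner_Integration.integrable_add Bochner_Integration.integrable_diff P.integrable_const
          Bochner_Integration.integrable_mult_right integral_mult_right_zero lebesgue_integral_const P.prob_space scaleR_one)
  also have "\<dots> \<le> 1 - 2 / m * m + 1 / m\<^sup>2 * m + 1 / m\<^sup>2 * (m\<^sup>2 * ?R)"
    unfolding f1 using f2 by (intro add_left_mono mult_left_mono) auto
  also have "\<dots> = ?R - 1 + 1 / m"
    using m0 by (simp add: power2_eq_square)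
  also have "\<dots> \<le> ?R - 1 + 1 / (real n * prob B * (1 - c * p) ^ (n - 1))"
    using I_ge low n I0 B(2) cp unfolding m_def by (intro add_left_mono divide_left_mono mult_pos_pos) auto
  finally show ?thesis .
qed

text \<open>Both \<open>n * p\<^sup>2\<close> and \<open>c * p\<close> tend to 0, and
  \<open>n * (1 - c * p) ^ (n - 1)\<close> grows like \<open>n\<close> to the power
  \<open>1 - c\<close>; the last is where \<open>c < 1\<close> is decisive.\<close>

lemma disconnected_limit:
  assumes B: "B \<in> sets M" "0 < prob B"
    and good: "AE x in M. good_point C x" and C: "0 \<le> C"
    and deg: "\<And>x. x \<in> B \<Longrightarrow> degree x \<le> c" and c: "0 < c" "c < 1"
  shows "(\<lambda>n. measure (random_graph M \<kappa> n) {G. graph_connected G}) \<longlonglongrightarrow> 0"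
proof -
  let ?p = "\<lambda>n. ln (real n) / real n"
  let ?u = "\<lambda>n. (1 + 4 * C * (?p n)\<^sup>2) ^ n / (1 - c * ?p n)\<^sup>2 - 1 + 1 / prob B * (1 / (real n * (1 - c * ?p n) ^ (n - 1)))"
  have "eventually (\<lambda>n. c * ?p n \<le> 1 / 2) sequentially"
    using c by real_asymp
  then have upper: "\<forall>\<^sub>F n in sequentially. measure (random_graph M \<kappa> n) {G. graph_connected G} \<le> ?u n"
    using eventually_ge_at_top[of 2]
  proof eventually_elim
    case (elim n)
    from connected_prob_le[OF B good C deg refl elim] show ?case
      by (simp add: mult_ac)
  qed
  have lim: "(\<lambda>n. (1 + 4 * C * (?p n)\<^sup>2) ^ n / (1 - c * ?p n)\<^sup>2 - 1) \<longlonglongrightarrow> 0"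
    using c C by real_asymp
  have "(\<lambda>n. 1 / (real n * (1 - c * ?p n) ^ (n - 1))) \<longlonglongrightarrow> 0"
    using c by real_asymp
  then have "(\<lambda>n. 1 / prob B * (1 / (real n * (1 - c * ?p n) ^ (n - 1)))) \<longlonglongrightarrow> 1 / prob B * 0"
    by (rule tendsto_mult_left)
  from tendsto_add[OF lim this] have "?u \<longlonglongrightarrow> 0"
    by (simp only: mult_zero_right add_0_right)
  from tendsto_sandwich[OF _ upper tendsto_const this] show ?thesis
    by simp
qed

section \<open>Small cuts\<close>

text \<open>Factors are at most 1, so those of vertices in \<open>S - T\<close> may be dropped. A
  subset \<open>T\<close> of suitable size keeps the quadratic remainder small however large
  \<open>S\<close> is, while the independent vertices are still those outside
  \<open>S\<close>.\<close>

lemma expected_cut_prob_le: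
  assumes S: "S \<subseteq> {1..n}" and T: "T \<subseteq> S" and k: "card T = k"
    and good: "AE x in M. good_point C x" and deg: "AE x in M. c \<le> degree x"
    and p: "p = ln (real n) / real n"
  shows "(\<integral>\<^sup>+X. ennreal (cut_prob \<kappa> n S X) \<partial>positions n)
     \<le> ennreal (exp (- (real k * p * (c - C * p - C * (real k * p) / 2) * real (n - card S))))"
proof -
  interpret PS: prob_space "PiM S (\<lambda>_. M)" by (intro prob_space_PiM prob_space_axioms)
  let ?z = "real k * p * (c - C * p - C * (real k * p) / 2)"
  have finS: "finite S" using S finite_subset by blast
  then have finT: "finite T" using T finite_subset by blast
  have "(\<integral>\<^sup>+X. ennreal (cut_prob \<kappa> n S X) \<partial>positions n)
    = (\<integral>\<^sup>+x. (\<integral>\<^sup>+y. ennreal (\<Prod>i\<in>S. 1 - link_prob \<kappa> n (x i) y) \<partial>M) ^ (n - card S) \<partial>PiM S (\<lambda>_. M))"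
    using nn_integral_cut_prob[OF S, of "\<lambda>_. 1"] by simp
  also have "\<dots> \<le> (\<integral>\<^sup>+x. ennreal (exp (- ?z * real (n - card S))) \<partial>PiM S (\<lambda>_. M))"
  proof (rule nn_integral_mono_AE)
    have "AE x in PiM S (\<lambda>_. M). \<forall>i\<in>S. good_point C (x i) \<and> c \<le> degree (x i)"
      using finS good deg by (intro AE_finite_allI AE_PiM_component prob_space_axioms) auto
    then show "AE x in PiM S (\<lambda>_. M). (\<integral>\<^sup>+y. ennreal (\<Prod>i\<in>S. 1 - link_prob \<kappa> n (x i) y) \<partial>M) ^ (n - card S)
        \<le> ennreal (exp (- ?z * real (n - card S)))"
    proof eventually_elim
      case (elim x)
      have sp: "x i \<in> space M" if "i \<in> T" for i using elim that T by (auto simp: good_point_def)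
      have le: "(\<Prod>i\<in>S. 1 - link_prob \<kappa> n (x i) y) \<le> (\<Prod>i\<in>T. 1 - link_prob \<kappa> n (x i) y)" for y
        using finS T by (intro prod_le_prod_subset) (auto simp: link_bounds)
      have int: "integrable M (\<lambda>y. \<Prod>i\<in>T. 1 - link_prob \<kappa> n (x i) y)"
      proof (rule integrable_const_bound[where B = 1])
        show "(\<lambda>y. \<Prod>i\<in>T. 1 - link_prob \<kappa> n (x i) y) \<in> borel_measurable M"
          using sp by (intro borel_measurable_prod borel_measurable_diff borel_measurable_const link_section_measurable)
        show "AE y in M. norm (\<Prod>i\<in>T. 1 - link_prob \<kappa> n (x i) y) \<le> 1"
          by (intro AE_I2) (auto simp: link_bounds abs_prod intro!: prod_le_1)
      qed
      have "(\<integral>\<^sup>+y. ennreal (\<Prod>i\<in>S. 1 - link_prob \<kappa> n (x i) y) \<partial>M)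
          \<le> (\<integral>\<^sup>+y. ennreal (\<Prod>i\<in>T. 1 - link_prob \<kappa> n (x i) y) \<partial>M)"
        using le by (intro nn_integral_mono ennreal_leI)
      also have "\<dots> = ennreal (\<integral>y. (\<Prod>i\<in>T. 1 - link_prob \<kappa> n (x i) y) \<partial>M)"
        using int by (intro nn_integral_eq_integral) (auto intro!: prod_nonneg simp: link_bounds)
      also have "\<dots> \<le> ennreal (1 - ?z)"
        using cut_section_integral_le[OF finT, of C x c p n] elim T p unfolding k by (intro ennreal_leI) auto
      also have "\<dots> \<le> ennreal (exp (- ?z))"
        using exp_ge_add_one_self[of "- ?z"] by (intro ennreal_leI) simp
      finally have "(\<integral>\<^sup>+y. ennreal (\<Prod>i\<in>S. 1 - link_prob \<kappa> n (x i) y) \<partial>M) ^ (n - card S)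
         \<le> ennreal (exp (- ?z)) ^ (n - card S)"
        by (rule power_mono) simp
      also have "\<dots> = ennreal (exp (- ?z * real (n - card S)))"
        by (simp add: ennreal_power exp_of_nat_mult[symmetric] mult.commute)
      finally show ?case .
    qed
  qed
  also have "\<dots> = ennreal (exp (- (?z * real (n - card S))))"
    by (simp add: PS.emeasure_space_1)
  finally show ?thesis .
qed

lemma sum_Pow_power_card:
  fixes q :: real
  assumes "finite A"
  shows "(\<Sum>S\<in>Pow A. q ^ card S) = (1 + q) ^ card A"
  using prod_add[OF assms, of "\<lambda>_. q" "\<lambda>_. 1"] by (simp add: add.commute)

text \<open>The first summand is for sets with at most \<open>\<delta> n / ln n\<close> elements. For a larger set only
  \<open>\<delta> n / ln n\<close> of its vertices are used; this already gives probability \<open>exp (- \<delta> n / 4)\<close>, which beats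
  the number of sets of size at most \<open>\<epsilon> n\<close> if \<open>\<epsilon>\<close> is small. The factors with \<open>L\<close> have product at least 1
  and make the sum over all \<open>S\<close> a binomial expansion.\<close>

lemma expected_small_cut_le:
  assumes S: "S \<subseteq> {1..n}" "real (card S) \<le> \<epsilon> * real n" and \<epsilon>: "\<epsilon> \<le> 1 / 4"
    and good: "AE x in M. good_point C x" and deg: "AE x in M. c \<le> degree x"
    and p: "p = ln (real n) / real n"
    and \<eta>: "0 < \<eta>" "1 + 3 * \<eta> \<le> c" and C: "0 < C" and \<delta>: "0 < \<delta>" "\<delta> \<le> 1" "C * \<delta> \<le> 2 * \<eta>"
    and large: "C * p \<le> \<eta>" "p \<le> \<delta> / 2" "0 < p" "1 + \<eta> \<le> \<eta> / 2 * ln (real n)" "0 < n" and L: "0 \<le> L"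
  shows "(\<integral>\<^sup>+X. ennreal (cut_prob \<kappa> n S X) \<partial>positions n)
    \<le> ennreal (exp (- (1 + \<eta> / 2) * ln (real n)) ^ card S
        + exp (- (\<delta> / 4) * real n + L * (\<epsilon> * real n)) * exp (- L) ^ card S)"
proof -
  have fin: "finite S" using S(1) finite_subset by blast
  have np: "real n * p = ln (real n)" using large p by simp
  have cardS: "card S \<le> n" using S(1) fin card_mono[of "{1..n}" S] by simp
  \<comment> \<open>Of the margin \<open>3 * \<eta>\<close>, truncation takes at most \<eta> and the
    quadratic remainder at most \<open>C * \<delta> / 2 \<le> \<eta>\<close>.\<close>
  have ge: "1 + \<eta> \<le> c - C * p - C * (real k * p) / 2" if "real k * p \<le> \<delta>" for k
  proof -
    have "C * (real k * p) \<le> C * \<delta>" using that C by (intro mult_left_mono) auto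
    then show ?thesis using \<eta> \<delta>(3) large(1) by linarith
  qed
  show ?thesis
  proof (cases "real (card S) * p \<le> \<delta>")
    case True
    let ?k = "real (card S)"
    \<comment> \<open>Since \<open>p * (n - card S) = ln n - card S * p\<close>, having fewer than
      \<open>n\<close> outside vertices costs at most \<delta>, hence at most 1, in the logarithm.
      Giving up half of \<eta> absorbs this for large \<open>n\<close>.\<close>
    have "?k * ((1 + \<eta> / 2) * ln (real n)) \<le> ?k * ((1 + \<eta>) * (ln (real n) - 1))"
      using large(4) by (intro mult_left_mono) (auto simp: algebra_simps)
    also have "\<dots> \<le> ?k * ((1 + \<eta>) * (ln (real n) - ?k * p))"
      using True \<delta>(2) \<eta> by (intro mult_left_mono) auto
    also have "\<dots> = ?k * p * (1 + \<eta>) * real (n - card S)"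
      using cardS by (simp add: of_nat_diff np[symmetric] algebra_simps)
    also have "\<dots> \<le> ?k * p * (c - C * p - C * (?k * p) / 2) * real (n - card S)"
      using ge[OF True] large(3) by (intro mult_right_mono mult_left_mono) auto
    finally have "exp (- (?k * p * (c - C * p - C * (?k * p) / 2) * real (n - card S)))
        \<le> exp (- (1 + \<eta> / 2) * ln (real n)) ^ card S"
      by (simp add: exp_of_nat_mult[symmetric] algebra_simps)
    also have "\<dots> \<le> exp (- (1 + \<eta> / 2) * ln (real n)) ^ card S
        + exp (- (\<delta> / 4) * real n + L * (\<epsilon> * real n)) * exp (- L) ^ card S"
      by simp
    finally show ?thesis
      using expected_cut_prob_le[OF S(1) order_refl refl good deg p] by (meson ennreal_leI order_trans)
  next
    case False
    \<comment> \<open>The largest size with \<open>k * p \<le> \<delta>\<close>; rounding loses at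
      most \<open>p \<le> \<delta> / 2\<close>.\<close>
    define k where "k = nat \<lfloor>\<delta> / p\<rfloor>"
    have kd: "real k \<le> \<delta> / p" "\<delta> / p - 1 \<le> real k"
      using \<delta>(1) large(3) unfolding k_def by (auto simp: of_nat_nat)
    then have k1: "real k * p \<le> \<delta>" and "\<delta> - p \<le> real k * p"
      using large(3) by (auto simp: field_simps)
    then have k2: "\<delta> / 2 \<le> real k * p" using large(2) by linarith
    have "\<delta> / p < real (card S)" using False large(3) by (simp add: field_simps)
    with kd(1) have "k \<le> card S" by linarith
    then obtain T where T: "T \<subseteq> S" "card T = k" by (metis obtain_subset_with_card_n)
    have half: "real n / 2 \<le> real (n - card S)"
    proof -
      have "\<epsilon> * real n \<le> 1 / 4 * real n" using \<epsilon> by (intro mult_right_mono) auto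
      then show ?thesis using S(2) cardS by (simp add: of_nat_diff)
    qed
    have "\<delta> / 4 * real n = \<delta> / 2 * 1 * (real n / 2)" by simp
    also have "\<dots> \<le> real k * p * (c - C * p - C * (real k * p) / 2) * real (n - card S)"
      using k2 ge[OF k1] half \<eta>(1) \<delta>(1) large(3) by (intro mult_mono mult_nonneg_nonneg) auto
    finally have "exp (- (real k * p * (c - C * p - C * (real k * p) / 2) * real (n - card S))) \<le> exp (- (\<delta> / 4) * real n)"
      by simp
    also have "\<dots> \<le> exp (- (\<delta> / 4) * real n + L * (\<epsilon> * real n) - L * real (card S))"
      using mult_left_mono[OF S(2) L] by simp
    also have "\<dots> = exp (- (\<delta> / 4) * real n + L * (\<epsilon> * real n)) * exp (- L) ^ card S"
      by (simp add: exp_of_nat_mult[symmetric] exp_add[symmetric] mult.commute)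
    also have "\<dots> \<le> exp (- (1 + \<eta> / 2) * ln (real n)) ^ card S
        + exp (- (\<delta> / 4) * real n + L * (\<epsilon> * real n)) * exp (- L) ^ card S"
      by simp
    finally show ?thesis
      using expected_cut_prob_le[OF S(1) T good deg p] by (meson ennreal_leI order_trans)
  qed
qed

text \<open>The threshold \<epsilon> is produced here and depends only on \<open>c\<close> and
  \<open>C\<close>; the precision of the open system is fitted to it afterwards.\<close>

lemma small_cuts_limit:
  assumes good: "AE x in M. good_point C x" and deg: "AE x in M. c \<le> degree x"
    and C: "0 < C" and c: "1 < c"
  obtains \<epsilon> u where "0 < \<epsilon>" "\<epsilon> \<le> 1 / 4" "u \<longlonglongrightarrow> 0"
    "\<forall>\<^sub>F n in sequentially. (\<integral>\<^sup>+X. ennreal (\<Sum>S\<in>{S. S \<subseteq> {1..n} \<and> S \<noteq> {} \<and> real (card S) \<le> \<epsilon> * real n}. cut_prob \<kappa> n S X) \<partial>positions n)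
        \<le> ennreal (u n)"
proof -
  define \<eta> where "\<eta> = (c - 1) / 3"
  have \<eta>: "0 < \<eta>" "1 + 3 * \<eta> \<le> c" using c by (auto simp: \<eta>_def diff_divide_distrib)
  define \<delta> where "\<delta> = min 1 (2 * \<eta> / C)"
  have \<delta>: "0 < \<delta>" "\<delta> \<le> 1" using \<eta> C by (auto simp: \<delta>_def)
  have "\<delta> \<le> 2 * \<eta> / C" by (simp add: \<delta>_def)
  with C have C\<delta>: "C * \<delta> \<le> 2 * \<eta>" by (simp add: field_simps)
  \<comment> \<open>With \<open>exp (- L) = \<delta> / 16\<close> the sum over all sets is at most
    \<open>exp (\<delta> * n / 16)\<close>. The choice of \<epsilon> makes the compensating factor
    equally small in exponent, so \<open>- \<delta> / 4\<close> deteriorates only to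
    \<open>- \<delta> / 8\<close>.\<close>
  define L where "L = ln (16 / \<delta>)"
  have L: "0 < L" "exp (- L) = \<delta> / 16" using \<delta> by (auto simp: L_def exp_minus field_simps)
  define \<epsilon> where "\<epsilon> = min (1 / 4) (\<delta> / (16 * L))"
  have \<epsilon>: "0 < \<epsilon>" "\<epsilon> \<le> 1 / 4" using \<delta> L by (auto simp: \<epsilon>_def)
  have "\<epsilon> \<le> \<delta> / (16 * L)" by (simp add: \<epsilon>_def)
  with L have L\<epsilon>: "L * \<epsilon> \<le> \<delta> / 16" by (simp add: field_simps)
  define q where "q n = exp (- (1 + \<eta> / 2) * ln (real n))" for n :: nat
  define u where "u n = exp (real n * q n) - 1 + exp (- (\<delta> / 8) * real n)" for n
  let ?F = "\<lambda>n. {S. S \<subseteq> {1..n} \<and> S \<noteq> {} \<and> real (card S) \<le> \<epsilon> * real n}"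
  have "(\<lambda>n. exp (real n * q n) - 1) \<longlonglongrightarrow> 0"
    unfolding q_def using \<eta> by real_asymp
  moreover have "(\<lambda>n. exp (- (\<delta> / 8) * real n)) \<longlonglongrightarrow> 0"
    using \<delta> by real_asymp
  ultimately have u: "u \<longlonglongrightarrow> 0"
    unfolding u_def by (auto intro: tendsto_eq_intros)
  have ev: "\<forall>\<^sub>F n in sequentially. C * (ln (real n) / real n) \<le> \<eta>" "\<forall>\<^sub>F n in sequentially. ln (real n) / real n \<le> \<delta> / 2"
    "\<forall>\<^sub>F n in sequentially. 0 < ln (real n) / real n" "\<forall>\<^sub>F n in sequentially. 1 + \<eta> \<le> \<eta> / 2 * ln (real n)"
    using C \<eta> \<delta> by real_asymp+
  have "\<forall>\<^sub>F n in sequentially. (\<integral>\<^sup>+X. ennreal (\<Sum>S\<in>?F n. cut_prob \<kappa> n S X) \<partial>positions n) \<le> ennreal (u n)"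
    using ev eventually_gt_at_top[of 0]
  proof eventually_elim
    case (elim n)
    let ?e = "exp (- (\<delta> / 4) * real n + L * (\<epsilon> * real n))"
    have fin: "finite (?F n)" by (rule finite_subset[of _ "Pow {1..n}"]) auto
    have "(\<integral>\<^sup>+X. ennreal (\<Sum>S\<in>?F n. cut_prob \<kappa> n S X) \<partial>positions n)
       = (\<integral>\<^sup>+X. (\<Sum>S\<in>?F n. ennreal (cut_prob \<kappa> n S X)) \<partial>positions n)"
      by (simp add: cut_prob_nonneg)
    also have "\<dots> = (\<Sum>S\<in>?F n. \<integral>\<^sup>+X. ennreal (cut_prob \<kappa> n S X) \<partial>positions n)"
      by (intro nn_integral_sum measurable_compose[OF cut_prob_measurable measurable_ennreal]) auto
    also have "\<dots> \<le> (\<Sum>S\<in>?F n. ennreal (q n ^ card S + ?e * exp (- L) ^ card S))"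
      unfolding q_def using L(1)
      by (intro sum_mono expected_small_cut_le[OF _ _ \<epsilon>(2) good deg refl \<eta> C \<delta> C\<delta> elim]) auto
    also have "\<dots> = ennreal (\<Sum>S\<in>?F n. q n ^ card S + ?e * exp (- L) ^ card S)"
      by (intro sum_ennreal) (auto simp: q_def)
    also have "\<dots> \<le> ennreal (u n)"
    proof (rule ennreal_leI)
      have q0: "0 \<le> q n" by (simp add: q_def)
      \<comment> \<open>Excluding the empty set removes the term 1; since \<open>n * q n\<close>
        tends to 0, the rest of the expansion vanishes.\<close>
      have "(\<Sum>S\<in>?F n. q n ^ card S) \<le> (\<Sum>S\<in>Pow {1..n} - {{}}. q n ^ card S)"
        using q0 by (intro sum_mono2) auto
      also have "\<dots> = (1 + q n) ^ n - 1"
        using sum_Pow_power_card[of "{1..n}" "q n"] by (subst sum_diff1) auto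
      also have "\<dots> \<le> exp (q n) ^ n - 1"
        using q0 by (intro diff_right_mono power_mono exp_ge_add_one_self) auto
      finally have 1: "(\<Sum>S\<in>?F n. q n ^ card S) \<le> exp (real n * q n) - 1"
        by (simp add: exp_of_nat_mult)
      have "(\<Sum>S\<in>?F n. exp (- L) ^ card S) \<le> (\<Sum>S\<in>Pow {1..n}. exp (- L) ^ card S)"
        by (intro sum_mono2) auto
      also have "\<dots> = (1 + exp (- L)) ^ n" by (subst sum_Pow_power_card) auto
      also have "\<dots> \<le> exp (exp (- L)) ^ n" by (intro power_mono exp_ge_add_one_self) auto
      also have "\<dots> = exp (real n * (\<delta> / 16))" unfolding L by (rule exp_of_nat_mult[symmetric])
      finally have "?e * (\<Sum>S\<in>?F n. exp (- L) ^ card S) \<le> ?e * exp (real n * (\<delta> / 16))"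
        by (rule mult_left_mono) simp
      also have "\<dots> = exp (- (\<delta> / 4) * real n + L * \<epsilon> * real n + \<delta> / 16 * real n)"
        by (simp add: exp_add[symmetric] mult_ac)
      also have "\<dots> \<le> exp (- (\<delta> / 8) * real n)"
      proof -
        have "L * \<epsilon> * real n \<le> \<delta> / 16 * real n" using L\<epsilon> by (rule mult_right_mono) simp
        then show ?thesis by simp
      qed
      finally have "?e * (\<Sum>S\<in>?F n. exp (- L) ^ card S) \<le> exp (- (\<delta> / 8) * real n)" .
      with 1 show "(\<Sum>S\<in>?F n. q n ^ card S + ?e * exp (- L) ^ card S) \<le> u n"
        by (simp add: u_def sum.distrib sum_distrib_left)
    qed
    finally show ?case .
  qed
  with \<epsilon> u show thesis by (rule that)
qed

end

section \<open>A finite connected system of sets\<close>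

text \<open>Each path uses finitely many pairs. The sets along the paths enter the field of
  \<open>E\<close> and may lie outside the family that is being connected.\<close>

lemma finite_subset_trancl:
  assumes "finite T" "T \<subseteq> R\<^sup>+"
  obtains E where "finite E" "E \<subseteq> R" "T \<subseteq> E\<^sup>+"
proof -
  have single: "\<exists>E. finite E \<and> E \<subseteq> R \<and> (a, b) \<in> E\<^sup>+" if "(a, b) \<in> R\<^sup>+" for a b
    using that
  proof (induction rule: trancl_induct)
    case (base b)
    then show ?case by (intro exI[of _ "{(a, b)}"]) auto
  next
    case (step b c)
    then obtain E where E: "finite E" "E \<subseteq> R" "(a, b) \<in> E\<^sup>+" by auto
    then have "(a, b) \<in> (insert (b, c) E)\<^sup>+" by (meson subset_insertI trancl_mono)
    then have "(a, c) \<in> (insert (b, c) E)\<^sup>+" by (rule trancl_into_trancl) simp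
    with E step show ?case by (intro exI[of _ "insert (b, c) E"]) auto
  qed
  have "\<exists>E. finite E \<and> E \<subseteq> R \<and> T \<subseteq> E\<^sup>+"
    using assms
  proof (induction rule: finite_induct)
    case empty
    show ?case by (intro exI[of _ "{}"]) auto
  next
    case (insert t T)
    then obtain E where E: "finite E" "E \<subseteq> R" "T \<subseteq> E\<^sup>+" by auto
    obtain a b where t: "t = (a, b)" by force
    with insert.prems have "(a, b) \<in> R\<^sup>+" by auto
    from single[OF this] t obtain E' where E': "finite E'" "E' \<subseteq> R" "t \<in> E'\<^sup>+" by auto
    have "E\<^sup>+ \<union> E'\<^sup>+ \<subseteq> (E \<union> E')\<^sup>+" by (auto intro: trancl_mono)
    with E E' show ?case by (intro exI[of _ "E \<union> E'"]) auto
  qed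
  then show thesis using that by auto
qed

text \<open>A discrete intermediate value principle. It is applied to a chain of regions, with
  \<open>P\<close> and \<open>Q\<close> saying that a region holds many vertices of \<open>S\<close>
  or of its complement.\<close>

lemma trancl_crossing:
  assumes "(a, b) \<in> E\<^sup>+" "P a" "Q b" "\<And>d. d \<in> Field E \<Longrightarrow> P d \<or> Q d"
  obtains x y where "(x, y) \<in> E" "P x" "Q y"
proof -
  have "\<exists>x y. (x, y) \<in> E \<and> P x \<and> Q y"
    using assms(1,3)
  proof (induction rule: trancl_induct)
    case (base y)
    with assms(2) show ?case by blast
  next
    case (step y z)
    then have "P y \<or> Q y" using assms(4) by (auto intro: FieldI1)
    with step show ?case by blast
  qed
  with that show thesis by blast
qed

lemma separable_countable_base:
  assumes "separable_space (euclidean :: 'a::metric_space topology)"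
  obtains \<B> :: "'a::metric_space set set" where "countable \<B>" "\<And>B. B \<in> \<B> \<Longrightarrow> open B"
    "\<And>U x. open U \<Longrightarrow> x \<in> U \<Longrightarrow> \<exists>B\<in>\<B>. x \<in> B \<and> B \<subseteq> U"
proof -
  from assms obtain D :: "'a set" where D: "countable D" "closure D = UNIV"
    by (auto simp: separable_space_def)
  define \<B> where "\<B> = (\<lambda>(d, q). ball d q) ` (D \<times> (\<rat> :: real set))"
  show thesis
  proof
    show "countable \<B>" unfolding \<B>_def using D countable_rat by (intro countable_image countable_SIGMA) auto
    show "open B" if "B \<in> \<B>" for B using that by (auto simp: \<B>_def)
    fix U :: "'a set" and x assume U: "open U" "x \<in> U"
    then obtain e where e: "e > 0" "ball x e \<subseteq> U" by (meson openE)
    have "x \<in> closure D" using D by simp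
    then obtain d where d: "d \<in> D" "dist d x < e / 4"
      using e(1) by (meson closure_approachable divide_pos_pos zero_less_numeral)
    \<comment> \<open>A radius above \<open>e / 4\<close> captures \<open>x\<close>; a radius below
      \<open>e / 2\<close> keeps the ball within distance \<open>e\<close> of
      \<open>x\<close>.\<close>
    obtain q where q: "q \<in> \<rat>" "e / 4 < q" "q < e / 2"
      using Rats_dense_in_real[of "e / 4" "e / 2"] e(1) by auto
    have "ball d q \<subseteq> ball x e"
    proof
      fix y assume "y \<in> ball d q"
      then have "dist d y < q" by simp
      then show "y \<in> ball x e"
        using dist_triangle[of x y d] dist_commute[of x d] d(2) q(3) e(1) by simp
    qed
    moreover have "x \<in> ball d q" using d q by simp
    ultimately show "\<exists>B\<in>\<B>. x \<in> B \<and> B \<subseteq> U"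
      using d q e(2) by (intro bexI[of _ "ball d q"]) (auto simp: \<B>_def)
  qed
qed

text \<open>\<open>F\<close> carries nearly all the mass, and \<open>E\<close> links its members,
  possibly through further sets; hence positive mass is demanded on all of \<open>Field E\<close>.
  The inclusion of the pairs \<open>(A, A)\<close> forces
  \<open>F \<subseteq> Field E\<close>.\<close>

definition backbone ::
    "'a measure \<Rightarrow> ('a \<Rightarrow> 'a \<Rightarrow> real) \<Rightarrow> real \<Rightarrow> 'a set set \<Rightarrow> ('a set \<times> 'a set) set \<Rightarrow> bool" where
  "backbone M \<kappa> \<epsilon> F E \<longleftrightarrow> finite F \<and> finite E \<and> F \<times> F \<subseteq> E\<^sup>+ \<and>
     (\<forall>A\<in>Field E. A \<in> sets M \<and> 0 < measure M A) \<and>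
     (\<exists>c>0. \<forall>(A, B)\<in>E. \<forall>x\<in>A. \<forall>y\<in>B. c \<le> \<kappa> x y) \<and>
     1 - \<epsilon> < measure M (\<Union>F)"

text \<open>The union of one class of linked base sets has no kernel mass towards its complement, so
  irreducibility makes it full. Irreducibility alone permits a vanishing kernel when \<mu> takes
  only the values 0 and 1; \<open>nonzero\<close> supplies a first link.\<close>

lemma backbone_exists:
  fixes M :: "'a::metric_space measure"
  assumes sep: "separable_space (euclidean :: 'a topology)"
    and prob: "prob_space M" and sets: "sets M = sets borel"
    and nonneg: "\<And>x y. 0 \<le> \<kappa> x y" and sym: "\<And>x y. \<kappa> x y = \<kappa> y x"
    and irred: "irreducible_kernel M \<kappa>"
    and cont: "AE z in M \<Otimes>\<^sub>M M. isCont (\<lambda>(x, y). \<kappa> x y) z"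
    and nonzero: "\<not> (AE (x, y) in M \<Otimes>\<^sub>M M. \<kappa> x y = 0)"
    and \<epsilon>: "0 < \<epsilon>"
  obtains F E where "backbone M \<kappa> \<epsilon> F E"
proof -
  interpret prob_space M by fact
  obtain \<B> :: "'a set set" where cB: "countable \<B>" and oB: "\<And>B. B \<in> \<B> \<Longrightarrow> open B"
    and base: "\<And>U x. open U \<Longrightarrow> x \<in> U \<Longrightarrow> \<exists>B\<in>\<B>. x \<in> B \<and> B \<subseteq> U"
    using separable_countable_base[OF sep] by metis
  have open_sets: "U \<in> sets M" if "open U" for U using that sets by simp
  define R where "R = {(A, B). A \<in> \<B> \<and> B \<in> \<B> \<and> 0 < prob A \<and> 0 < prob B \<and>
      (\<exists>c>0. \<forall>x\<in>A. \<forall>y\<in>B. c \<le> \<kappa> x y)}"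
  have R_sym: "sym R" unfolding R_def sym_def using sym by (auto, metis)
  \<comment> \<open>These are the points of the support; a countable base makes them almost all
    points.\<close>
  define pos where "pos x \<longleftrightarrow> (\<forall>B\<in>\<B>. x \<in> B \<longrightarrow> 0 < prob B)" for x
  have "AE x in M. pos x"
    unfolding pos_def
  proof (rule AE_ball_countable'[OF _ cB])
    fix B assume B: "B \<in> \<B>"
    show "AE x in M. x \<in> B \<longrightarrow> 0 < prob B"
    proof (cases "prob B = 0")
      case True
      then have "B \<in> null_sets M" using open_sets[OF oB[OF B]] by (simp add: null_sets_def emeasure_eq_measure)
      from AE_not_in[OF this] show ?thesis by eventually_elim simp
    next
      case False
      then have "0 < prob B" by (simp add: zero_less_measure_iff)
      then show ?thesis by simp
    qed
  qed
  then obtain N where N: "{x \<in> space M. \<not> pos x} \<subseteq> N" and "emeasure M N = 0" "N \<in> events"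
    by (rule AE_E)
  then have "N \<in> null_sets M" by (intro null_setsI)
  then have "AE z in M \<Otimes>\<^sub>M M. z \<notin> N \<times> space M" "AE z in M \<Otimes>\<^sub>M M. z \<notin> space M \<times> N"
    by (intro AE_not_in times_in_null_sets1 times_in_null_sets2 sets.top; assumption)+
  then have good: "AE z in M \<Otimes>\<^sub>M M. pos (fst z) \<and> pos (snd z) \<and> isCont (\<lambda>(x, y). \<kappa> x y) z"
    using cont AE_space
  proof eventually_elim
    case (elim z)
    then show ?case using N by (cases z) (auto simp: space_pair_measure)
  qed
  have link: "\<exists>A B. x \<in> A \<and> y \<in> B \<and> (A, B) \<in> R"
    if "pos x" "pos y" "isCont (\<lambda>(x, y). \<kappa> x y) (x, y)" "\<kappa> x y \<noteq> 0" for x y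
  proof -
    have k: "0 < \<kappa> x y" using nonneg[of x y] that(4) by linarith
    have "((\<lambda>(x, y). \<kappa> x y) \<longlongrightarrow> \<kappa> x y) (nhds (x, y))"
      using that(3) tendsto_at_iff_tendsto_nhds[of "\<lambda>(x, y). \<kappa> x y" "(x, y)"] by (simp add: isCont_def)
    then have "eventually (\<lambda>z. \<kappa> x y / 2 < (\<lambda>(x, y). \<kappa> x y) z) (nhds (x, y))"
      using k by (intro order_tendstoD(1)) auto
    then obtain W where W: "open W" "(x, y) \<in> W" "\<forall>z\<in>W. \<kappa> x y / 2 < (\<lambda>(x, y). \<kappa> x y) z"
      unfolding eventually_nhds by blast
    from open_prod_elim[OF W(1,2)] obtain U V
      where UV: "open U" "open V" "(x, y) \<in> U \<times> V" "U \<times> V \<subseteq> W" by metis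
    obtain A where A: "A \<in> \<B>" "x \<in> A" "A \<subseteq> U" using base[OF UV(1), of x] UV(3) by auto
    obtain B where B: "B \<in> \<B>" "y \<in> B" "B \<subseteq> V" using base[OF UV(2), of y] UV(3) by auto
    have "\<forall>u\<in>A. \<forall>v\<in>B. \<kappa> x y / 2 \<le> \<kappa> u v"
      using W(3) UV(4) A(3) B(3) by fastforce
    then have "(A, B) \<in> R"
      using A B that(1,2) k unfolding R_def pos_def by (auto intro!: exI[of _ "\<kappa> x y / 2"])
    with A B show ?thesis by blast
  qed
  have "\<exists>A0 B0. (A0, B0) \<in> R"
  proof (rule ccontr)
    assume none: "\<not> (\<exists>A0 B0. (A0, B0) \<in> R)"
    have "AE (x, y) in M \<Otimes>\<^sub>M M. \<kappa> x y = 0"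
      using good
    proof eventually_elim
      case (elim z)
      with none link[of "fst z" "snd z"] show ?case by (cases z) auto
    qed
    with nonzero show False by simp
  qed
  then obtain A0 B0 where A0: "(A0, B0) \<in> R" by blast
  define C where "C = {B. (A0, B) \<in> R\<^sup>+}"
  have C_R: "\<exists>A. (A, B) \<in> R" if "B \<in> C" for B
    using that unfolding C_def by (auto elim: tranclE)
  then have C_sub: "C \<subseteq> \<B>" by (auto simp: R_def)
  \<comment> \<open>Symmetry gives the return path from \<open>A0\<close> through
    \<open>B0\<close>.\<close>
  have A0C: "A0 \<in> C"
    using A0 R_sym unfolding C_def by (auto intro: trancl_into_trancl dest: symD)
  have cC: "countable C" using C_sub cB countable_subset by blast
  define U where "U = \<Union>C"
  have Uo: "open U" unfolding U_def using C_sub oB by (intro open_Union) auto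
  have zero: "AE (x, y) in M \<Otimes>\<^sub>M M. (x, y) \<in> U \<times> (space M - U) \<longrightarrow> \<kappa> x y = 0"
    using good
  proof eventually_elim
    case (elim z)
    obtain x y where z: "z = (x, y)" by force
    have "\<kappa> x y = 0" if x: "x \<in> U" and y: "y \<notin> U"
    proof (rule ccontr)
      assume "\<kappa> x y \<noteq> 0"
      with elim z obtain A B where AB: "x \<in> A" "y \<in> B" "(A, B) \<in> R"
        using link[of x y] by auto
      from x obtain D where D: "D \<in> C" "x \<in> D" by (auto simp: U_def)
      from D obtain K where K: "(A0, K) \<in> R\<^sup>*" "(K, D) \<in> R"
        unfolding C_def by (metis mem_Collect_eq tranclD2)
      \<comment> \<open>The set \<open>D\<close> of the class and the set \<open>A\<close> of the
        new link overlap at \<open>x\<close>. A base set inside the overlap inherits both lower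
        bounds and has positive mass, so it joins the class to \<open>B\<close>, contradicting
        \<open>y \<notin> U\<close>.\<close>
      have "open (A \<inter> D)" using AB K oB by (auto simp: R_def)
      then obtain I where I: "I \<in> \<B>" "x \<in> I" "I \<subseteq> A" "I \<subseteq> D"
        using base[of "A \<inter> D" x] AB(1) D(2) by auto
      have "0 < prob I" using elim z I by (auto simp: pos_def)
      then have "(K, I) \<in> R" "(I, B) \<in> R"
        using K(2) AB(3) I unfolding R_def by (auto, (meson subsetD)+)
      with K(1) have "(A0, B) \<in> R\<^sup>+" by (meson rtrancl_into_trancl1 trancl_into_trancl)
      with AB(2) y show False by (auto simp: U_def C_def)
    qed
    then show ?case using z by auto
  qed
  have U0: "0 < prob U"
  proof -
    have "0 < prob A0" using A0 by (auto simp: R_def)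
    also have "prob A0 \<le> prob U"
      using A0C Uo open_sets by (intro finite_measure_mono) (auto simp: U_def)
    finally show ?thesis .
  qed
  have U1: "prob U = 1"
  proof (rule ccontr)
    assume "prob U \<noteq> 1"
    then have "prob U < 1" using prob_le_1[of U] by linarith
    with U0 zero open_sets[OF Uo] have "reducible M \<kappa>" unfolding reducible_def by blast
    with irred show False by simp
  qed
  define G where "G n = (\<Union>i\<le>n. from_nat_into C i)" for n :: nat
  have fC: "from_nat_into C i \<in> C" for i using A0C by (intro from_nat_into) auto
  have "range (from_nat_into C) = C" using A0C cC by (intro range_from_nat_into) auto
  moreover have "(\<Union>n. G n) = \<Union>(range (from_nat_into C))" unfolding G_def by auto
  ultimately have UG: "(\<Union>n. G n) = U" by (simp add: U_def)
  have "(\<lambda>n. prob (G n)) \<longlonglongrightarrow> prob (\<Union>n. G n)"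
  proof (rule finite_Lim_measure_incseq)
    show "range G \<subseteq> events"
      unfolding G_def using fC C_sub oB open_sets by (intro image_subsetI sets.finite_UN) auto
    show "incseq G" unfolding G_def by (intro monoI UN_mono) auto
  qed
  then have "(\<lambda>n. prob (G n)) \<longlonglongrightarrow> 1" by (simp add: UG U1)
  then have "eventually (\<lambda>n. 1 - \<epsilon> < prob (G n)) sequentially"
    using \<epsilon> by (intro order_tendstoD) auto
  then obtain n where n: "1 - \<epsilon> < prob (G n)" by (auto simp: eventually_sequentially)
  define F where "F = from_nat_into C ` {..n}"
  have F: "finite F" "F \<subseteq> C" "\<Union>F = G n" using fC by (auto simp: F_def G_def)
  have "(A, B) \<in> R\<^sup>+" if "A \<in> C" "B \<in> C" for A B
  proof -
    have "(A, A0) \<in> R\<^sup>+" "(A0, B) \<in> R\<^sup>+"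
      using that symD[OF sym_trancl[OF R_sym]] by (auto simp: C_def)
    then show ?thesis by (rule trancl_trans)
  qed
  with F(2) have "F \<times> F \<subseteq> R\<^sup>+" by blast
  then obtain E where E: "finite E" "E \<subseteq> R" "F \<times> F \<subseteq> E\<^sup>+"
    by (rule finite_subset_trancl[OF finite_cartesian_product[OF F(1) F(1)]])
  have "\<forall>e\<in>E. \<exists>c>0. \<forall>x\<in>fst e. \<forall>y\<in>snd e. c \<le> \<kappa> x y"
  proof
    fix e assume "e \<in> E"
    then have "e \<in> R" using E(2) by blast
    then show "\<exists>c>0. \<forall>x\<in>fst e. \<forall>y\<in>snd e. c \<le> \<kappa> x y"
      unfolding R_def by (cases e) simp
  qed
  then obtain f where f: "\<And>e. e \<in> E \<Longrightarrow> 0 < f e" "\<And>e x y. e \<in> E \<Longrightarrow> x \<in> fst e \<Longrightarrow> y \<in> snd e \<Longrightarrow> f e \<le> \<kappa> x y"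
    by metis
  have "\<exists>c>0. \<forall>(A, B)\<in>E. \<forall>x\<in>A. \<forall>y\<in>B. c \<le> \<kappa> x y"
  proof (intro exI conjI)
    \<comment> \<open>The inserted 1 keeps the minimum defined and positive when \<open>E\<close> is
      empty.\<close>
    show "0 < Min (insert 1 (f ` E))" using E(1) f(1) by auto
    have "Min (insert 1 (f ` E)) \<le> \<kappa> x y" if "(A, B) \<in> E" "x \<in> A" "y \<in> B" for A B x y
    proof -
      have "Min (insert 1 (f ` E)) \<le> f (A, B)" using E(1) that(1) by (intro Min_le) auto
      also have "\<dots> \<le> \<kappa> x y" using f(2)[OF that(1)] that(2,3) by simp
      finally show ?thesis .
    qed
    then show "\<forall>(A, B)\<in>E. \<forall>x\<in>A. \<forall>y\<in>B. Min (insert 1 (f ` E)) \<le> \<kappa> x y" by blast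
  qed
  moreover have "\<forall>A\<in>Field E. A \<in> sets M \<and> 0 < prob A"
    using E(2) oB open_sets unfolding R_def Field_def by blast
  ultimately show thesis
    using that[of F E] E F n unfolding backbone_def by auto
qed

section \<open>Large cuts\<close>

context kernel_space
begin

section \<open>Typical occupation counts\<close>

definition occupancy :: "nat \<Rightarrow> (nat \<Rightarrow> 'a) \<Rightarrow> 'a set \<Rightarrow> real" where
  "occupancy n X A = real (card {i\<in>{1..n}. X i \<in> A})"

lemma occupancy_measurable:
  assumes "A \<in> sets M"
  shows "(\<lambda>X. occupancy n X A) \<in> borel_measurable (positions n)"
proof -
  have "occupancy n X A = (\<Sum>i\<in>{1..n}. indicator A (X i))" for X
    unfolding occupancy_def indicator_def of_bool_def
    by (subst sum.If_cases) (auto simp: Int_def intro!: arg_cong[where f = card])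
  moreover have "(\<lambda>X. indicator A (X i) :: real) \<in> borel_measurable (positions n)" if "i \<in> {1..n}" for i
    using measurable_compose[OF measurable_component_singleton[OF that] borel_measurable_indicator[OF assms]] .
  ultimately show ?thesis by (simp add: borel_measurable_sum)
qed

definition atypical :: "nat \<Rightarrow> real \<Rightarrow> 'a set set \<Rightarrow> 'a set set \<Rightarrow> (nat \<Rightarrow> 'a) set" where
  "atypical n \<epsilon> F \<A> = {X \<in> space (positions n).
     (\<exists>A\<in>\<A>. occupancy n X A \<le> prob A / 4 * real n) \<or> \<epsilon> / 2 * real n \<le> occupancy n X (space M - \<Union>F)}"

text \<open>The constants fit \<open>count_tail\<close> with \<open>t = - 1\<close> and
  \<open>t = 1\<close>. As \<open>exp (- 1) - 1 \<le> - 1 / 2\<close>, the threshold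
  \<open>prob A / 4\<close> leaves the exponent \<open>- prob A / 4\<close>. As
  \<open>exp 1 - 1 \<le> 2\<close>, uncovered mass at most \<open>\<epsilon> / 8\<close> against the
  threshold \<open>\<epsilon> / 2\<close> leaves \<open>- \<epsilon> / 4\<close>.\<close>

lemma atypical_prob:
  assumes \<A>: "finite \<A>" "\<A> \<subseteq> sets M" and F: "\<Union>F \<in> sets M" "1 - \<epsilon> / 8 < prob (\<Union>F)"
  shows "atypical n \<epsilon> F \<A> \<in> sets (positions n)"
    and "measure (positions n) (atypical n \<epsilon> F \<A>)
      \<le> (\<Sum>A\<in>\<A>. exp (- (prob A / 4) * real n)) + exp (- (\<epsilon> / 4) * real n)"
proof -
  interpret P: prob_space "positions n" by (rule prob_space_positions)
  define L where "L A = {X \<in> space (positions n). occupancy n X A \<le> prob A / 4 * real n}" for A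
  define H where "H = {X \<in> space (positions n). \<epsilon> / 2 * real n \<le> occupancy n X (space M - \<Union>F)}"
  have eq: "atypical n \<epsilon> F \<A> = (\<Union>A\<in>\<A>. L A) \<union> H"
    by (auto simp: atypical_def L_def H_def)
  have Lm: "L A \<in> sets (positions n)" if "A \<in> \<A>" for A
    using occupancy_measurable[of A n] that \<A>(2) unfolding L_def by (intro borel_measurable_le) auto
  have Hm: "H \<in> sets (positions n)"
    using occupancy_measurable[of "space M - \<Union>F" n] F(1) unfolding H_def by (intro borel_measurable_le) auto
  show "atypical n \<epsilon> F \<A> \<in> sets (positions n)"
    unfolding eq using Lm Hm \<A>(1) by (intro sets.Un sets.finite_UN) auto
  have e1: "exp (- 1) \<le> (1 / 2 :: real)"
    using exp_ge_add_one_self[of 1] by (simp add: exp_minus field_simps)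
  have L: "measure (positions n) (L A) \<le> exp (- (prob A / 4) * real n)" if "A \<in> \<A>" for A
  proof -
    have "measure (positions n) (L A) \<le> exp (real n * (prob A * (exp (- 1) - 1) - - 1 * (prob A / 4)))"
      using count_tail[of A n "- 1" "prob A / 4"] that \<A>(2) by (auto simp: L_def occupancy_def)
    also have "\<dots> \<le> exp (- (prob A / 4) * real n)"
    proof -
      have "prob A * (exp (- 1) - 1) \<le> prob A * (- 1 / 2)" using e1 by (intro mult_left_mono) auto
      then have "real n * (prob A * (exp (- 1) - 1) - - 1 * (prob A / 4)) \<le> real n * (- (prob A / 4))"
        by (intro mult_left_mono) auto
      then show ?thesis by (simp add: mult.commute)
    qed
    finally show ?thesis .
  qed
  have H: "measure (positions n) H \<le> exp (- (\<epsilon> / 4) * real n)"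
  proof -
    let ?w = "prob (space M - \<Union>F)"
    have w: "?w \<le> \<epsilon> / 8" using F by (simp add: prob_compl)
    have "measure (positions n) H \<le> exp (real n * (?w * (exp 1 - 1) - 1 * (\<epsilon> / 2)))"
      using count_tail[of "space M - \<Union>F" n 1 "\<epsilon> / 2"] F(1) by (auto simp: H_def occupancy_def)
    also have "\<dots> \<le> exp (- (\<epsilon> / 4) * real n)"
    proof -
      have "?w * (exp 1 - 1) \<le> ?w * 2" using exp_le by (intro mult_left_mono) auto
      then have "real n * (?w * (exp 1 - 1) - 1 * (\<epsilon> / 2)) \<le> real n * (- (\<epsilon> / 4))"
        using w by (intro mult_left_mono) auto
      then show ?thesis by (simp add: mult.commute)
    qed
    finally show ?thesis .
  qed
  have "measure (positions n) (atypical n \<epsilon> F \<A>) \<le> measure (positions n) (\<Union>A\<in>\<A>. L A) + measure (positions n) H"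
    unfolding eq using Lm Hm \<A>(1) by (intro measure_Un_le sets.finite_UN) auto
  also have "measure (positions n) (\<Union>A\<in>\<A>. L A) \<le> (\<Sum>A\<in>\<A>. measure (positions n) (L A))"
    using Lm \<A>(1) by (intro P.finite_measure_subadditive_finite) auto
  also have "\<dots> \<le> (\<Sum>A\<in>\<A>. exp (- (prob A / 4) * real n))" using L by (rule sum_mono)
  finally show "measure (positions n) (atypical n \<epsilon> F \<A>)
      \<le> (\<Sum>A\<in>\<A>. exp (- (prob A / 4) * real n)) + exp (- (\<epsilon> / 4) * real n)"
    using H by linarith
qed

text \<open>By pigeonhole, some region of \<open>F\<close> is rich in \<open>S\<close> and another
  rich in the complement. Every region on a path between them is rich in one of the two, so some
  link of \<open>E\<close> passes from one kind to the other and exposes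
  \<open>(\<tau> * n)\<^sup>2\<close> absent pairs.\<close>

lemma large_cut_prob_le:
  assumes F: "finite F" "F \<noteq> {}" "F \<times> F \<subseteq> E\<^sup>+"
    and c: "0 < c" "\<And>A B x y. (A, B) \<in> E \<Longrightarrow> x \<in> A \<Longrightarrow> y \<in> B \<Longrightarrow> c \<le> \<kappa> x y"
    and S: "S \<subseteq> {1..n}" "\<epsilon> * real n < real (card S)" "\<epsilon> * real n < real (card ({1..n} - S))"
    and occ: "\<And>A. A \<in> Field E \<Longrightarrow> 2 * \<tau> * real n \<le> occupancy n X A"
    and out: "real (card {i\<in>{1..n}. X i \<notin> \<Union>F}) \<le> \<epsilon> / 2 * real n"
    and \<tau>: "0 \<le> \<tau>" "\<tau> * real (card F) \<le> \<epsilon> / 2"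
    and p: "p = ln (real n) / real n" "c * p \<le> 1"
  shows "cut_prob \<kappa> n S X \<le> exp (- (c * p * (\<tau> * real n)\<^sup>2))"
proof -
  have pigeon: "\<exists>A\<in>F. \<tau> * real n \<le> real (card {i\<in>V. X i \<in> A})"
    if V: "V \<subseteq> {1..n}" "\<epsilon> * real n < real (card V)" for V
  proof (rule ccontr)
    assume "\<not> ?thesis"
    then have less: "real (card {i\<in>V. X i \<in> A}) < \<tau> * real n" if "A \<in> F" for A using that by force
    have finV: "finite V" using V(1) finite_subset by blast
    have "card V \<le> card ({i\<in>{1..n}. X i \<notin> \<Union>F} \<union> (\<Union>A\<in>F. {i\<in>V. X i \<in> A}))"
      using V(1) finV F(1) by (intro card_mono) auto
    also have "\<dots> \<le> card {i\<in>{1..n}. X i \<notin> \<Union>F} + (\<Sum>A\<in>F. card {i\<in>V. X i \<in> A})"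
      by (intro order_trans[OF card_Un_le] add_left_mono card_UN_le F)
    finally have "real (card V) \<le> real (card {i\<in>{1..n}. X i \<notin> \<Union>F} + (\<Sum>A\<in>F. card {i\<in>V. X i \<in> A}))"
      by (simp only: of_nat_le_iff)
    also have "\<dots> = real (card {i\<in>{1..n}. X i \<notin> \<Union>F}) + (\<Sum>A\<in>F. real (card {i\<in>V. X i \<in> A}))"
      by simp
    also have "\<dots> \<le> \<epsilon> / 2 * real n + (\<Sum>A\<in>F. \<tau> * real n)"
      using out less by (intro add_mono sum_mono) (auto intro: less_imp_le)
    also have "\<dots> = \<epsilon> / 2 * real n + \<tau> * real (card F) * real n" by simp
    also have "\<dots> \<le> \<epsilon> / 2 * real n + \<epsilon> / 2 * real n"
      using \<tau>(2) by (intro add_left_mono mult_right_mono) auto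
    finally show False using V(2) by simp
  qed
  obtain A where A: "A \<in> F" "\<tau> * real n \<le> real (card {i\<in>S. X i \<in> A})"
    using pigeon[OF S(1,2)] by auto
  obtain B where B: "B \<in> F" "\<tau> * real n \<le> real (card {i\<in>{1..n} - S. X i \<in> B})"
    using pigeon[OF _ S(3)] by auto
  have finS: "finite S" using S(1) finite_subset by blast
  \<comment> \<open>A region with \<open>2 * \<tau> * n\<close> vertices has at least half of them
    on one side.\<close>
  have "\<tau> * real n \<le> real (card {i\<in>S. X i \<in> D}) \<or> \<tau> * real n \<le> real (card {i\<in>{1..n} - S. X i \<in> D})"
    if D: "D \<in> Field E" for D
  proof -
    have "{i\<in>{1..n}. X i \<in> D} = {i\<in>S. X i \<in> D} \<union> {i\<in>{1..n} - S. X i \<in> D}" using S(1) by auto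
    then have "occupancy n X D = real (card {i\<in>S. X i \<in> D}) + real (card {i\<in>{1..n} - S. X i \<in> D})"
      unfolding occupancy_def using finS by (simp, subst card_Un_disjoint) auto
    with occ[OF D] show ?thesis by linarith
  qed
  with A B F(3) obtain A' B' where E: "(A', B') \<in> E" "\<tau> * real n \<le> real (card {i\<in>S. X i \<in> A'})"
      "\<tau> * real n \<le> real (card {i\<in>{1..n} - S. X i \<in> B'})"
    using trancl_crossing[of A B E "\<lambda>D. \<tau> * real n \<le> real (card {i\<in>S. X i \<in> D})"
        "\<lambda>D. \<tau> * real n \<le> real (card {i\<in>{1..n} - S. X i \<in> D})"] by blast
  let ?SA = "{i\<in>S. X i \<in> A'}" and ?SB = "{i\<in>{1..n} - S. X i \<in> B'}"
  have p0: "0 \<le> p" using ln_div_nonneg p by simp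
  have cp0: "0 \<le> c * p" using c(1) p0 by simp
  have "cut_prob \<kappa> n S X \<le> (\<Prod>j\<in>?SB. \<Prod>i\<in>S. 1 - link_prob \<kappa> n (X i) (X j))"
    unfolding cut_prob_def
    by (intro prod_le_prod_subset prod_nonneg prod_le_1) (auto simp: link_bounds)
  also have "\<dots> \<le> (\<Prod>j\<in>?SB. \<Prod>i\<in>?SA. 1 - link_prob \<kappa> n (X i) (X j))"
    using finS by (intro prod_mono conjI prod_le_prod_subset prod_nonneg) (auto simp: link_bounds)
  also have "\<dots> \<le> (\<Prod>j\<in>?SB. \<Prod>i\<in>?SA. exp (- (c * p)))"
  proof (intro prod_mono conjI prod_nonneg)
    fix i j assume ij: "j \<in> ?SB" "i \<in> ?SA"
    then have "c * p \<le> \<kappa> (X i) (X j) * p" using c(2)[OF E(1)] p0 by (intro mult_right_mono) auto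
    \<comment> \<open>The bound \<open>c * p \<le> 1\<close> lets the lower estimate pass through
      the truncation.\<close>
    then have "c * p \<le> link_prob \<kappa> n (X i) (X j)" using p by (simp add: link_prob_def)
    then show "1 - link_prob \<kappa> n (X i) (X j) \<le> exp (- (c * p))"
      using exp_ge_add_one_self[of "- (c * p)"] by linarith
  qed (auto simp: link_bounds)
  also have "\<dots> = exp (- (c * p * (real (card ?SA) * real (card ?SB))))"
    by (simp add: power_mult[symmetric] exp_of_nat_mult[symmetric] mult_ac)
  also have "\<dots> \<le> exp (- (c * p * (\<tau> * real n)\<^sup>2))"
  proof -
    have "(\<tau> * real n)\<^sup>2 \<le> real (card ?SA) * real (card ?SB)"
      unfolding power2_eq_square using E(2,3) \<tau>(1) by (intro mult_mono) auto
    then show ?thesis using cp0 by (simp add: mult_left_mono)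
  qed
  finally show ?thesis .
qed

lemma connected_limit:
  assumes good: "AE x in M. good_point C x" and deg: "AE x in M. c \<le> degree x"
    and C: "0 < C" and c: "1 < c"
    and bb: "\<And>\<epsilon>. 0 < \<epsilon> \<Longrightarrow> \<exists>F E. backbone M \<kappa> \<epsilon> F E"
  shows "(\<lambda>n. measure (random_graph M \<kappa> n) {G. graph_connected G}) \<longlonglongrightarrow> 1"
proof -
  obtain \<epsilon> u where \<epsilon>: "0 < \<epsilon>" "\<epsilon> \<le> 1 / 4" and u: "u \<longlonglongrightarrow> 0"
    and small: "\<forall>\<^sub>F n in sequentially. (\<integral>\<^sup>+X. ennreal (\<Sum>S\<in>{S. S \<subseteq> {1..n} \<and> S \<noteq> {} \<and> real (card S) \<le> \<epsilon> * real n}. cut_prob \<kappa> n S X) \<partial>positions n)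
        \<le> ennreal (u n)"
    by (rule small_cuts_limit[OF good deg C c], rule that)
  obtain F E where "backbone M \<kappa> (\<epsilon> / 8) F E" using bb[of "\<epsilon> / 8"] \<epsilon> by auto
  then have F: "finite F" "finite E" "F \<times> F \<subseteq> E\<^sup>+" "1 - \<epsilon> / 8 < prob (\<Union>F)"
    and E: "\<And>A. A \<in> Field E \<Longrightarrow> A \<in> sets M \<and> 0 < prob A"
    and "\<exists>b>0. \<forall>(A, B)\<in>E. \<forall>x\<in>A. \<forall>y\<in>B. b \<le> \<kappa> x y"
    unfolding backbone_def by auto
  then obtain b where b: "0 < b" "\<And>A B x y. (A, B) \<in> E \<Longrightarrow> x \<in> A \<Longrightarrow> y \<in> B \<Longrightarrow> b \<le> \<kappa> x y"
    by fast
  have finE: "finite (Field E)" using F(2) by (rule finite_Field)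
  have FE: "F \<subseteq> Field E"
  proof
    fix A assume "A \<in> F"
    with F(3) have "(A, A) \<in> E\<^sup>+" by auto
    then show "A \<in> Field E" by (meson FieldI1 tranclD)
  qed
  have UF: "\<Union>F \<in> sets M" using F(1) FE E by (intro sets.finite_Union) auto
  have Fne: "F \<noteq> {}" using F(4) \<epsilon> by auto
  \<comment> \<open>The first entry serves the pigeonhole argument; the others make
    \<open>2 * \<tau> * n\<close> at most the typical occupancy bound
    \<open>prob A / 4 * n\<close>.\<close>
  define \<tau> where "\<tau> = Min (insert (\<epsilon> / (2 * real (card F))) ((\<lambda>A. prob A / 8) ` Field E))"
  have cF: "0 < card F" using Fne F(1) by (simp add: card_gt_0_iff)
  have \<tau>0: "0 < \<tau>" unfolding \<tau>_def using finE E cF \<epsilon> by auto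
  have "\<tau> \<le> \<epsilon> / (2 * real (card F))" unfolding \<tau>_def using finE by (intro Min_le) auto
  then have \<tau>F: "\<tau> * real (card F) \<le> \<epsilon> / 2" using cF by (simp add: field_simps)
  have \<tau>E: "\<tau> \<le> prob A / 8" if "A \<in> Field E" for A unfolding \<tau>_def using finE that by (intro Min_le) auto
  define v where "v n = (\<Sum>A\<in>Field E. exp (- (prob A / 4) * real n)) + exp (- (\<epsilon> / 4) * real n)" for n :: nat
  define w where "w n = 2 ^ n * exp (- (b * \<tau>\<^sup>2 * (real n * ln (real n))))" for n :: nat
  have expn: "(\<lambda>n. exp (- a * real n)) \<longlonglongrightarrow> 0" if "0 < a" for a
    using that by real_asymp
  have "v \<longlonglongrightarrow> (\<Sum>A\<in>Field E. 0) + 0"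
    unfolding v_def using E \<epsilon> by (intro tendsto_add tendsto_sum expn) auto
  then have v: "v \<longlonglongrightarrow> 0" by simp
  define a where "a = b * \<tau>\<^sup>2"
  have a0: "0 < a" using b \<tau>0 by (simp add: a_def)
  have w: "w \<longlonglongrightarrow> 0"
    unfolding w_def a_def[symmetric] using a0 by real_asymp
  have ev: "\<forall>\<^sub>F n in sequentially. b * (ln (real n) / real n) \<le> 1" using b(1) by real_asymp
  have bound: "\<forall>\<^sub>F n in sequentially. measure (random_graph M \<kappa> n) {G. \<not> graph_connected G} \<le> \<bar>u n\<bar> + (w n + v n)"
    using small ev eventually_gt_at_top[of 0]
  proof eventually_elim
    case (elim n)
    let ?small = "{S. S \<subseteq> {1..n} \<and> S \<noteq> {} \<and> real (card S) \<le> \<epsilon> * real n}"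
    let ?large = "{S. S \<subseteq> {1..n} \<and> \<epsilon> * real n < real (card S) \<and> \<epsilon> * real n < real (card ({1..n} - S))}"
    let ?Z = "atypical n \<epsilon> F (Field E)"
    let ?nc = "\<lambda>X. measure_pmf.prob (graph_pmf \<kappa> n X) {G. \<not> graph_connected G}"
    interpret P: prob_space "positions n" by (rule prob_space_positions)
    have Z: "?Z \<in> sets (positions n)" "measure (positions n) ?Z \<le> v n"
      using atypical_prob[OF finE _ UF F(4)] E unfolding v_def by auto
    have fin: "finite ?small" "finite ?large"
      by (rule finite_subset[of _ "Pow {1..n}"]; auto)+
    have w0: "0 \<le> w n" by (simp add: w_def)
    have large: "(\<Sum>S\<in>?large. cut_prob \<kappa> n S X) \<le> w n" if X: "X \<in> space (positions n)" "X \<notin> ?Z" for X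
    proof -
      have sp: "X i \<in> space M" if "i \<in> {1..n}" for i using X(1) that by (auto simp: space_PiM)
      have "{i\<in>{1..n}. X i \<notin> \<Union>F} = {i\<in>{1..n}. X i \<in> space M - \<Union>F}" using sp by auto
      then have out: "real (card {i\<in>{1..n}. X i \<notin> \<Union>F}) \<le> \<epsilon> / 2 * real n"
        using X by (auto simp: atypical_def occupancy_def)
      have occ: "2 * \<tau> * real n \<le> occupancy n X A" if "A \<in> Field E" for A
      proof -
        have "2 * \<tau> * real n \<le> prob A / 4 * real n"
          using \<tau>E[OF that] by (intro mult_right_mono) auto
        also have "\<dots> \<le> occupancy n X A" using X that by (auto simp: atypical_def)
        finally show ?thesis .
      qed
      have "(\<Sum>S\<in>?large. cut_prob \<kappa> n S X)
          \<le> (\<Sum>S\<in>?large. exp (- (b * (ln (real n) / real n) * (\<tau> * real n)\<^sup>2)))"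
        using \<tau>0 by (intro sum_mono large_cut_prob_le[OF F(1) Fne F(3) b _ _ _ occ out _ \<tau>F refl elim(2)]) auto
      also have "b * (ln (real n) / real n) * (\<tau> * real n)\<^sup>2 = b * \<tau>\<^sup>2 * (real n * ln (real n))"
        using elim(3) by (simp add: power2_eq_square field_simps)
      also have "(\<Sum>S\<in>?large. exp (- (b * \<tau>\<^sup>2 * (real n * ln (real n)))))
          \<le> (\<Sum>S\<in>Pow {1..n}. exp (- (b * \<tau>\<^sup>2 * (real n * ln (real n)))))"
        by (intro sum_mono2) auto
      also have "\<dots> = w n" by (simp add: w_def card_Pow)
      finally show ?thesis .
    qed
    \<comment> \<open>Atypical positions are charged 1 for the whole union of cuts, not for each
      \<open>S\<close>, so their exponentially small probability suffices.\<close>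
    have ptw: "?nc X \<le> (\<Sum>S\<in>?small. cut_prob \<kappa> n S X) + (w n + indicator ?Z X)" if X: "X \<in> space (positions n)" for X
    proof (cases "X \<in> ?Z")
      case True
      have "0 \<le> (\<Sum>S\<in>?small. cut_prob \<kappa> n S X)" by (intro sum_nonneg cut_prob_nonneg)
      moreover have "?nc X \<le> 1" by simp
      moreover have "indicator ?Z X = (1 :: real)" using True by simp
      ultimately show ?thesis using w0 by linarith
    next
      case False
      have "?nc X \<le> (\<Sum>S\<in>?small \<union> ?large. cut_prob \<kappa> n S X)"
      proof (rule prob_not_connected_le[OF kernel_nonneg kernel_sym])
        show "S \<in> ?small \<union> ?large \<or> {1..n} - S \<in> ?small \<union> ?large"
          if "S \<subseteq> {1..n}" "S \<noteq> {}" "S \<noteq> {1..n}" for S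
        proof -
          have "{1..n} - S \<noteq> {}" using that by auto
          then show ?thesis using that by auto
        qed
      qed auto
      also have "\<dots> = (\<Sum>S\<in>?small. cut_prob \<kappa> n S X) + (\<Sum>S\<in>?large. cut_prob \<kappa> n S X)"
        using fin by (intro sum.union_disjoint) auto
      finally show ?thesis using large[OF X False] False by simp
    qed
    have "ennreal (measure (random_graph M \<kappa> n) {G. \<not> graph_connected G}) = (\<integral>\<^sup>+X. ennreal (?nc X) \<partial>positions n)"
      by (rule random_graph_prob(2))
    also have "\<dots> \<le> (\<integral>\<^sup>+X. ennreal (\<Sum>S\<in>?small. cut_prob \<kappa> n S X) + (ennreal (w n) + indicator ?Z X) \<partial>positions n)"
    proof (rule nn_integral_mono)
      fix X assume X: "X \<in> space (positions n)"
      have "ennreal (?nc X) \<le> ennreal ((\<Sum>S\<in>?small. cut_prob \<kappa> n S X) + (w n + indicator ?Z X))"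
        using ptw[OF X] by (rule ennreal_leI)
      also have "\<dots> = ennreal (\<Sum>S\<in>?small. cut_prob \<kappa> n S X) + (ennreal (w n) + indicator ?Z X)"
        using w0 by (simp add: sum_nonneg cut_prob_nonneg ennreal_plus ennreal_indicator del: sum_ennreal)
      finally show "ennreal (?nc X) \<le> ennreal (\<Sum>S\<in>?small. cut_prob \<kappa> n S X) + (ennreal (w n) + indicator ?Z X)" .
    qed
    also have "\<dots> = (\<integral>\<^sup>+X. ennreal (\<Sum>S\<in>?small. cut_prob \<kappa> n S X) \<partial>positions n)
        + (ennreal (w n) + emeasure (positions n) ?Z)"
    proof -
      have "(\<lambda>X. \<Sum>S\<in>?small. cut_prob \<kappa> n S X) \<in> borel_measurable (positions n)"
        by (intro borel_measurable_sum cut_prob_measurable) auto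
      then show ?thesis
        using Z(1) by (simp add: nn_integral_add P.emeasure_space_1 del: sum_ennreal)
    qed
    also have "\<dots> \<le> ennreal \<bar>u n\<bar> + (ennreal (w n) + ennreal (v n))"
    proof (intro add_mono order_refl)
      \<comment> \<open>The sign of \<open>u n\<close> is unknown and \<open>ennreal\<close> sends
        negative reals to 0; the absolute value allows the sum to be taken in the reals.\<close>
      show "(\<integral>\<^sup>+X. ennreal (\<Sum>S\<in>?small. cut_prob \<kappa> n S X) \<partial>positions n) \<le> ennreal \<bar>u n\<bar>"
        using elim(1) by (rule order_trans) (intro ennreal_leI abs_ge_self)
      show "emeasure (positions n) ?Z \<le> ennreal (v n)"
        using Z(2) by (simp add: P.emeasure_eq_measure ennreal_leI)
    qed
    also have "\<dots> = ennreal (\<bar>u n\<bar> + (w n + v n))"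
    proof -
      have "0 \<le> v n" by (simp add: v_def sum_nonneg)
      with w0 show ?thesis by (simp add: ennreal_plus)
    qed
    finally show ?case
      using w0 by (subst (asm) ennreal_le_iff) (auto simp: v_def sum_nonneg)
  qed
  have "(\<lambda>n. \<bar>u n\<bar> + (w n + v n)) \<longlonglongrightarrow> \<bar>0\<bar> + (0 + 0)"
    using u v w by (intro tendsto_add tendsto_rabs)
  then have lim: "(\<lambda>n. \<bar>u n\<bar> + (w n + v n)) \<longlonglongrightarrow> 0" by simp
  have "(\<lambda>n. measure (random_graph M \<kappa> n) {G. \<not> graph_connected G}) \<longlonglongrightarrow> 0"
    using tendsto_sandwich[OF _ bound tendsto_const lim] by simp
  from tendsto_diff[OF tendsto_const[of 1] this] show ?thesis
    by (simp add: random_graph_connected_eq)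
qed

end

section \<open>The threshold\<close>

theorem theorem1:
  fixes \<mu> :: "'a::metric_space measure" and \<kappa> :: "'a \<Rightarrow> 'a \<Rightarrow> real"
  assumes "separable_space (euclidean :: 'a topology)"
    and "prob_space \<mu>" and "sets \<mu> = sets borel"
    and "\<And>x y. 0 \<le> \<kappa> x y" and "\<And>x y. \<kappa> x y = \<kappa> y x"
    and "integrable (\<mu> \<Otimes>\<^sub>M \<mu>) (\<lambda>(x, y). \<kappa> x y)"
    and "irreducible_kernel \<mu> \<kappa>"
    and "AE z in \<mu> \<Otimes>\<^sub>M \<mu>. isCont (\<lambda>(x, y). \<kappa> x y) z"
    and "esssup \<mu> (lambda2 \<mu> \<kappa>) < \<infinity>"
  shows "(lambda_star \<mu> \<kappa> < 1 \<longrightarrow>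
            (\<lambda>n. measure (random_graph \<mu> \<kappa> n) {G. graph_connected G}) \<longlonglongrightarrow> 0) \<and>
         (lambda_star \<mu> \<kappa> > 1 \<longrightarrow>
            (\<lambda>n. measure (random_graph \<mu> \<kappa> n) {G. graph_connected G}) \<longlonglongrightarrow> 1)"
proof -
  interpret prob_space \<mu> by fact
  interpret kernel_space \<mu> \<kappa>
    by standard (use assms in \<open>auto dest: borel_measurable_integrable\<close>)
  obtain K where K: "0 \<le> K" "esssup \<mu> (lambda2 \<mu> \<kappa>) = ennreal K"
    using assms(9) by (cases "esssup \<mu> (lambda2 \<mu> \<kappa>)") auto
  \<comment> \<open>Adding 1 keeps \<open>C\<close> positive when \<open>K = 0\<close>; the
    small-cut estimate divides by \<open>C\<close>.\<close>
  define C where "C = K\<^sup>2 + 1"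
  have C: "0 < C" using zero_le_power2[of K] by (simp add: C_def add_nonneg_pos)
  have "AE x in \<mu>. lambda2 \<mu> \<kappa> x \<le> ennreal K"
    using esssup_AE[where M = \<mu> and f = "lambda2 \<mu> \<kappa>"] K by simp
  then have good: "AE x in \<mu>. good_point C x"
    using AE_space
  proof eventually_elim
    case (elim x)
    let ?t = "\<integral>\<^sup>+y. ennreal ((\<kappa> x y)\<^sup>2) \<partial>\<mu>"
    have fin: "?t \<noteq> \<infinity>" using elim(1) by (auto simp: lambda2_def ennreal_sqrt_def top_unique)
    have "sqrt (enn2real ?t) \<le> K"
      using elim(1) fin K(1) by (simp add: lambda2_def ennreal_sqrt_def)
    then have "enn2real ?t \<le> K\<^sup>2" by (rule sqrt_le_D)
    moreover have m: "(\<lambda>y. (\<kappa> x y)\<^sup>2) \<in> borel_measurable \<mu>"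
      using kernel_section_measurable[OF elim(2)] by measurable
    have "integrable \<mu> (\<lambda>y. (\<kappa> x y)\<^sup>2)"
      using m fin by (intro integrableI_nonneg) (auto simp: less_top[symmetric])
    moreover have "(\<integral>y. (\<kappa> x y)\<^sup>2 \<partial>\<mu>) = enn2real ?t"
      using m by (intro integral_eq_nn_integral) auto
    ultimately show ?case using elim(2) by (simp add: good_point_def C_def)
  qed
  have lam: "lambda \<mu> \<kappa> x = ennreal (degree x)" if "good_point C x" for x
    unfolding lambda_def degree_def
    using good_point_integrable[OF that] kernel_nonneg by (intro nn_integral_eq_integral) auto
  have deg_m: "degree \<in> borel_measurable \<mu>"
    unfolding degree_def[abs_def] using kernel_measurable by (intro borel_measurable_lebesgue_integral) simp
  have "(\<lambda>n. measure (random_graph \<mu> \<kappa> n) {G. graph_connected G}) \<longlonglongrightarrow> 0" if "lambda_star \<mu> \<kappa> < 1"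
  proof -
    from dense[OF that] obtain r' where r': "lambda_star \<mu> \<kappa> < r'" "r' < 1" by auto
    then obtain r where r: "r' = ennreal r" "0 \<le> r" by (cases r') auto
    have r01: "0 < r" "r < 1" using r' r by (auto simp: ennreal_less_one_iff intro: order_le_neq_trans)
    define B where "B = {x \<in> space \<mu>. degree x < r}"
    have B: "B \<in> sets \<mu>" unfolding B_def using deg_m by measurable
    \<comment> \<open>Otherwise \<open>r\<close> would be an almost sure lower bound for
      \<open>lambda\<close>, contradicting \<open>lambda_star \<mu> \<kappa> < r'\<close>.\<close>
    have "0 < prob B"
    proof (rule ccontr)
      assume "\<not> 0 < prob B"
      then have "B \<in> null_sets \<mu>" using B by (simp add: null_sets_def emeasure_eq_measure zero_less_measure_iff)
      from AE_not_in[OF this] good AE_space have "AE x in \<mu>. ennreal r \<le> lambda \<mu> \<kappa> x"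
      proof eventually_elim
        case (elim x)
        then show ?case by (auto simp: lam B_def intro: ennreal_leI)
      qed
      then have "ennreal r \<le> lambda_star \<mu> \<kappa>"
        unfolding lambda_star_def essinf_def by (intro Sup_upper) simp
      with r r' show False by auto
    qed
    with B good C r01 show ?thesis
      by (intro disconnected_limit[of B C r]) (auto simp: B_def)
  qed
  moreover have "(\<lambda>n. measure (random_graph \<mu> \<kappa> n) {G. graph_connected G}) \<longlonglongrightarrow> 1" if "lambda_star \<mu> \<kappa> > 1"
  proof -
    from that obtain s where s: "AE x in \<mu>. s \<le> lambda \<mu> \<kappa> x" "1 < s"
      unfolding lambda_star_def essinf_def less_Sup_iff by auto
    from dense[OF s(2)] obtain r' where r': "1 < r'" "r' < s" by auto
    then obtain r where r: "r' = ennreal r" "0 \<le> r" by (cases r') auto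
    have r1: "1 < r" using r' r by (metis ennreal_1 ennreal_less_iff zero_le_one)
    have deg: "AE x in \<mu>. r \<le> degree x"
      using s(1) good
    proof eventually_elim
      case (elim x)
      have "ennreal r \<le> ennreal (degree x)" using elim r r' lam by simp
      \<comment> \<open>A negative degree would be sent to 0 by \<open>ennreal\<close>, which the
        bound by \<open>r > 1\<close> excludes.\<close>
      then show ?case using r1 by (cases "0 \<le> degree x") (auto simp: ennreal_neg)
    qed
    interpret P: pair_sigma_finite \<mu> \<mu> ..
    \<comment> \<open>A kernel vanishing almost everywhere would have degree 0 almost everywhere,
      against the lower bound \<open>r > 1\<close>.\<close>
    have "\<not> (AE (x, y) in \<mu> \<Otimes>\<^sub>M \<mu>. \<kappa> x y = 0)"
    proof
      assume "AE (x, y) in \<mu> \<Otimes>\<^sub>M \<mu>. \<kappa> x y = 0"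
      then have "AE x in \<mu>. AE y in \<mu>. \<kappa> x y = 0" using P.AE_pair[of "\<lambda>(x, y). \<kappa> x y = 0"] by simp
      with deg have "AE x in \<mu>. False"
      proof eventually_elim
        case (elim x)
        have "degree x = 0" unfolding degree_def using elim(2) by (rule integral_eq_zero_AE)
        with elim(1) r1 show ?case by simp
      qed
      then show False using AE_False by simp
    qed
    then have "\<exists>F E. backbone \<mu> \<kappa> \<epsilon> F E" if "0 < \<epsilon>" for \<epsilon>
      using backbone_exists[OF assms(1,2,3,4,5,7,8) _ that] by metis
    with good deg C r1 show ?thesis by (rule connected_limit)
  qed
  ultimately show ?thesis by blast
qed

end
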